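(* Let $t,\alpha\in\mathbb C$ with $t\notin\{-1,-2,\dots\}$. Then the function on Young diagrams (partitions) $\mu$ $$\varphi_{t,\alpha}(\mu)=\frac{(\mu_1-1)!\cdots(\mu_l-1)!}{r_1(\mu)!\,r_2(\mu)!\cdots}\cdot\frac{t(t+\alpha)\cdots(t+(l-1)\alpha)}{(t)_n}\cdot\prod_{\substack{b=(i,j)\in\mu\\ j\ge2}}\Big(1-\frac{\alpha}{j-1}\Big),$$ where $n=|\mu|$ and $l$ is the number of nonzero parts of $\mu$, is harmonic on the Kingman graph: $\varphi_{t,\alpha}(\mu)=\sum_{\lambda\searrow\mu}\varkappa_0(\mu,\lambda)\varphi_{t,\alpha}(\lambda)$ for all $\mu$. Moreover, there is a multiplicative linear functional $\pi_{t,\alpha}:\Lambda\to\mathbb C$ with $$\pi_{t,\alpha}(m^*_\mu)=(-1)^n\frac{(\mu_1-1)!\cdots(\mu_l-1)!}{r_1(\mu)!\,r_2(\mu)!\cdots}\,t(t+\alpha)\cdots(t+(l-1)\alpha)\prod_{\substack{b=(i,j)\in\mu\\ j\ge2}}\Big(1-\frac{\alpha}{j-1}\Big)$$ for all $\mu$, so that $\varphi_{t,\alpha}(\mu)=(-1)^{|\mu|}\pi_{t,\alpha}(m^*_\mu)/(t)_{|\mu|}$.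
   Context: A partition $\mu=(\mu_1\ge\cdots\ge\mu_l>0)$, also written $(1^{r_1(\mu)}2^{r_2(\mu)}\cdots)$ where $r_k(\mu)$ is the number of parts equal to $k$, is identified with its Young diagram; boxes $b=(i,j)$ (row $i$, column $j$); for $\mu=\varnothing$ all products are empty and equal $1$. $\lambda\searrow\mu$ means $\lambda$ is $\mu$ plus one box. The Kingman graph is the Young graph with edge multiplicities $\varkappa_0(\mu,\lambda)=r_k(\lambda)$, where $k$ is the length of the row of $\lambda$ containing the box $\lambda\setminus\mu$ (equivalently $m_\mu m_{(1)}=\sum_{\lambda\searrow\mu}\varkappa_0(\mu,\lambda)m_\lambda$ for monomial symmetric functions $m_\mu$). $(t)_n=t(t+1)\cdots(t+n-1)$. $\Lambda$ is the algebra of symmetric functions in $x_1,x_2,\dots$. The factorial monomial symmetric function $m^*_\mu\in\Lambda$ is the sum of all distinct expressions obtained from $\prod_{i=1}^l x_i(x_i-1)\cdots(x_i-\mu_i+1)$ by permutations of the variables; the $m^*_\mu$ form a basis of $\Lambda$.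
   Formalization: At t = 0 the quotient t(t+α)⋯(t+(l−1)α)/(t)_n is 0/0 for nonempty μ; there φ is read with the common factor t cancelled, and the final formula φ = (−1)^n π(m*_μ)/(t)_n is stated as a quotient only for t ≠ 0 or μ = ∅, and multiplied out by (t)_n in general. *)

theory Defs
  imports Complex_Main "HOL-Library.Poly_Mapping"
begin

section \<open>Monomials and symmetric functions\<close>

text \<open>
  The variables are \<open>x 0, x 1, x 2, \<dots>\<close>; a monomial is its finitely supported exponent function,
  and monomials are multiplied by adding exponents. Symmetric functions are formal power series of
  bounded degree, given by their coefficient functions, that are invariant under all permutations
  of the variables.
\<close>

type_synonym monom = "nat \<Rightarrow>\<^sub>0 nat"

definition mdeg :: "monom \<Rightarrow> nat" where
  "mdeg m = (\<Sum>i\<in>Poly_Mapping.keys m. Poly_Mapping.lookup m i)"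

definition symmetric_series :: "(monom \<Rightarrow> complex) \<Rightarrow> bool" where
  "symmetric_series f \<longleftrightarrow> (\<forall>p m. bij p \<longrightarrow> f (Poly_Mapping.map_key p m) = f m)"

definition bounded_degree :: "(monom \<Rightarrow> complex) \<Rightarrow> bool" where
  "bounded_degree f \<longleftrightarrow> (\<exists>d. \<forall>m. f m \<noteq> 0 \<longrightarrow> mdeg m \<le> d)"

definition cauchy_prod :: "(monom \<Rightarrow> complex) \<Rightarrow> (monom \<Rightarrow> complex) \<Rightarrow> monom \<Rightarrow> complex" where
  "cauchy_prod f g m = (\<Sum>(a, b)\<in>{(a, b). a + b = m}. f a * g b)"

lemma mdeg_superset:
  assumes "finite A" "Poly_Mapping.keys m \<subseteq> A"
  shows "mdeg m = (\<Sum>i\<in>A. Poly_Mapping.lookup m i)"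
  unfolding mdeg_def using assms
  by (intro sum.mono_neutral_left) (auto simp: in_keys_iff)

lemma mdeg_add: "mdeg (a + b) = mdeg a + mdeg b"
proof -
  let ?A = "Poly_Mapping.keys a \<union> Poly_Mapping.keys b"
  have "mdeg (a + b) = (\<Sum>i\<in>?A. Poly_Mapping.lookup (a + b) i)"
    using keys_add[of a b] by (intro mdeg_superset) auto
  also have "\<dots> = (\<Sum>i\<in>?A. Poly_Mapping.lookup a i) + (\<Sum>i\<in>?A. Poly_Mapping.lookup b i)"
    by (simp add: lookup_add sum.distrib)
  also have "\<dots> = mdeg a + mdeg b"
    by (simp add: mdeg_superset[where A = ?A])
  finally show ?thesis .
qed

lemma mdeg_zero [simp]: "mdeg 0 = 0"
  by (simp add: mdeg_def)

lemma mdeg_single: "mdeg (Poly_Mapping.single i e) = e"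
  by (cases "e = 0") (simp_all add: mdeg_def)

lemma lookup_map_key:
  assumes "inj p"
  shows "Poly_Mapping.lookup (Poly_Mapping.map_key p m) i = Poly_Mapping.lookup m (p i)"
  using assms by (simp add: map_key.rep_eq)

lemma map_key_inv:
  assumes "bij p"
  shows "Poly_Mapping.map_key p (Poly_Mapping.map_key (inv p) m) = m"
    "Poly_Mapping.map_key (inv p) (Poly_Mapping.map_key p m) = m"
  using assms bij_imp_bij_inv[OF assms]
  by (auto intro!: poly_mapping_eqI simp: lookup_map_key bij_is_inj bij_is_surj surj_f_inv_f)

lemma bij_map_key:
  assumes "bij p"
  shows "bij (Poly_Mapping.map_key p :: monom \<Rightarrow> monom)"
  by (rule bij_betw_byWitness[where f' = "Poly_Mapping.map_key (inv p)"])
    (use map_key_inv[OF assms] in auto)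

lemma finite_splits: "finite {(a, b). a + b = (m :: monom)}"
proof -
  let ?K = "Poly_Mapping.keys m"
  let ?F = "{f :: nat \<Rightarrow> nat. \<forall>i. (i \<in> ?K \<longrightarrow> f i \<in> {..mdeg m}) \<and> (i \<notin> ?K \<longrightarrow> f i = 0)}"
  have F: "finite ?F"
    by (intro finite_set_of_finite_funs) auto
  have le: "Poly_Mapping.lookup m i \<le> mdeg m" for i
  proof (cases "i \<in> ?K")
    case True
    then show ?thesis
      unfolding mdeg_def by (intro member_le_sum) auto
  qed (simp add: in_keys_iff)
  have "(\<lambda>(a, b). (Poly_Mapping.lookup a, Poly_Mapping.lookup b)) ` {(a, b). a + b = m} \<subseteq> ?F \<times> ?F"
  proof clarsimp
    fix a b :: monom
    assume m: "m = a + b"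
    show "(\<forall>i. (i \<in> Poly_Mapping.keys (a + b) \<longrightarrow> Poly_Mapping.lookup a i \<le> mdeg (a + b)) \<and>
               (i \<notin> Poly_Mapping.keys (a + b) \<longrightarrow> Poly_Mapping.lookup a i = 0)) \<and>
          (\<forall>i. (i \<in> Poly_Mapping.keys (a + b) \<longrightarrow> Poly_Mapping.lookup b i \<le> mdeg (a + b)) \<and>
               (i \<notin> Poly_Mapping.keys (a + b) \<longrightarrow> Poly_Mapping.lookup b i = 0))"
      using le unfolding m by (auto simp: in_keys_iff lookup_add)
        (metis add_leE)+
  qed
  moreover have "inj_on (\<lambda>(a, b). (Poly_Mapping.lookup a, Poly_Mapping.lookup b)) {(a, b). a + b = m}"
    by (auto simp: inj_on_def poly_mapping.lookup_inject)
  ultimately show ?thesis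
    using F by (meson finite_SigmaI finite_imageD finite_subset)
qed

lemma cauchy_prod_commute: "cauchy_prod f g = cauchy_prod g f"
proof
  fix m
  show "cauchy_prod f g m = cauchy_prod g f m"
    unfolding cauchy_prod_def
    by (rule sum.reindex_bij_witness[where i = prod.swap and j = prod.swap])
      (auto simp: add.commute mult.commute)
qed

lemma cauchy_prod_assoc: "cauchy_prod (cauchy_prod f g) h = cauchy_prod f (cauchy_prod g h)"
proof
  fix m
  have "cauchy_prod (cauchy_prod f g) h m =
      (\<Sum>s\<in>{(a, b). a + b = m}. \<Sum>r\<in>{(c, d). c + d = fst s}. f (fst r) * g (snd r) * h (snd s))"
    by (simp add: cauchy_prod_def sum_distrib_right split_def)
  also have "\<dots> = (\<Sum>(s, r)\<in>Sigma {(a, b). a + b = m} (\<lambda>s. {(c, d). c + d = fst s}).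
      f (fst r) * g (snd r) * h (snd s))"
    by (subst sum.Sigma) (auto simp: finite_splits)
  also have "\<dots> = (\<Sum>(s, r)\<in>Sigma {(a, b). a + b = m} (\<lambda>s. {(c, d). c + d = snd s}).
      f (fst s) * (g (fst r) * h (snd r)))"
    by (rule sum.reindex_bij_witness[where
          j = "\<lambda>((a, b), (c, d)). ((c, d + b), (d, b))" and
          i = "\<lambda>((a, b), (c, d)). ((a + c, d), (a, c))"])
      (auto simp: add.assoc mult.assoc)
  also have "\<dots> = (\<Sum>s\<in>{(a, b). a + b = m}. \<Sum>r\<in>{(c, d). c + d = snd s}. f (fst s) * (g (fst r) * h (snd r)))"
    by (subst sum.Sigma) (auto simp: finite_splits)
  also have "\<dots> = cauchy_prod f (cauchy_prod g h) m"
    by (simp add: cauchy_prod_def sum_distrib_left split_def)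
  finally show "cauchy_prod (cauchy_prod f g) h m = cauchy_prod f (cauchy_prod g h) m" .
qed

lemma cauchy_prod_one: "cauchy_prod (\<lambda>m. if m = 0 then 1 else 0) f = f"
proof
  fix m
  have "cauchy_prod (\<lambda>m. if m = 0 then 1 else 0) f m =
      (\<Sum>(a, b)\<in>{(0 :: monom, m)}. (if a = 0 then 1 else 0) * f b)"
    unfolding cauchy_prod_def
    by (rule sum.mono_neutral_right) (auto simp: finite_splits split: if_splits)
  then show "cauchy_prod (\<lambda>m. if m = 0 then 1 else 0) f m = f m"
    by simp
qed

lemma cauchy_prod_add: "cauchy_prod (\<lambda>m. f m + g m) h = (\<lambda>m. cauchy_prod f h m + cauchy_prod g h m)"
  by (simp add: fun_eq_iff cauchy_prod_def split_def sum.distrib distrib_right)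

lemma symmetric_series_cauchy_prod:
  assumes "symmetric_series f" "symmetric_series g"
  shows "symmetric_series (cauchy_prod f g)"
  unfolding symmetric_series_def
proof safe
  fix p :: "nat \<Rightarrow> nat" and m :: monom
  assume p: "bij p"
  note i = bij_is_inj[OF p] bij_is_inj[OF bij_imp_bij_inv[OF p]]
  show "cauchy_prod f g (Poly_Mapping.map_key p m) = cauchy_prod f g m"
    unfolding cauchy_prod_def
    by (rule sum.reindex_bij_witness[where
          i = "map_prod (Poly_Mapping.map_key p) (Poly_Mapping.map_key p)" and
          j = "map_prod (Poly_Mapping.map_key (inv p)) (Poly_Mapping.map_key (inv p))"])
      (use assms p in \<open>auto simp: map_key_inv map_key_plus[symmetric] i symmetric_series_def bij_imp_bij_inv\<close>)
qed

lemma bounded_degree_cauchy_prod: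
  assumes "bounded_degree f" "bounded_degree g"
  shows "bounded_degree (cauchy_prod f g)"
proof -
  from assms obtain d e where d: "\<And>m. f m \<noteq> 0 \<Longrightarrow> mdeg m \<le> d" and e: "\<And>m. g m \<noteq> 0 \<Longrightarrow> mdeg m \<le> e"
    unfolding bounded_degree_def by blast
  have "mdeg m \<le> d + e" if "cauchy_prod f g m \<noteq> 0" for m
  proof -
    from that obtain a b where "a + b = m" "f a * g b \<noteq> 0"
      unfolding cauchy_prod_def by (auto elim!: sum.not_neutral_contains_not_neutral)
    then show ?thesis
      using d[of a] e[of b] mdeg_add[of a b] by auto
  qed
  then show ?thesis
    unfolding bounded_degree_def by blast
qed

lemma bounded_degree_add:
  assumes "bounded_degree f" "bounded_degree g"
  shows "bounded_degree (\<lambda>m. f m + g m)"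
proof -
  from assms obtain d e where d: "\<And>m. f m \<noteq> 0 \<Longrightarrow> mdeg m \<le> d" and e: "\<And>m. g m \<noteq> 0 \<Longrightarrow> mdeg m \<le> e"
    unfolding bounded_degree_def by blast
  have "mdeg m \<le> max d e" if "f m + g m \<noteq> 0" for m
    using that d[of m] e[of m] by (cases "f m = 0") auto
  then show ?thesis
    unfolding bounded_degree_def by blast
qed

typedef symfun = "{f. symmetric_series f \<and> bounded_degree f}"
  morphisms coeff_sf Abs_symfun
  by (rule exI[of _ "\<lambda>_. 0"]) (simp add: symmetric_series_def bounded_degree_def)

setup_lifting type_definition_symfun

instantiation symfun :: comm_ring_1
begin

lift_definition zero_symfun :: symfun is "\<lambda>_. 0"
  by (simp add: symmetric_series_def bounded_degree_def)

lift_definition one_symfun :: symfun is "\<lambda>m. if m = 0 then 1 else 0"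
proof -
  have "Poly_Mapping.map_key p m = 0 \<longleftrightarrow> m = 0" if "bij p" for p :: "nat \<Rightarrow> nat" and m :: monom
    using map_key_inv[OF that, of m] that
    by (metis map_key_zero bij_is_inj bij_imp_bij_inv)
  then show "symmetric_series (\<lambda>m. if m = 0 then 1 else 0) \<and> bounded_degree (\<lambda>m. if m = 0 then 1 else 0)"
    by (auto simp: symmetric_series_def bounded_degree_def)
qed

lift_definition plus_symfun :: "symfun \<Rightarrow> symfun \<Rightarrow> symfun" is "\<lambda>f g m. f m + g m"
  by (auto simp: bounded_degree_add) (simp add: symmetric_series_def)

lift_definition uminus_symfun :: "symfun \<Rightarrow> symfun" is "\<lambda>f m. - f m"
  by (simp add: symmetric_series_def bounded_degree_def)

definition minus_symfun :: "symfun \<Rightarrow> symfun \<Rightarrow> symfun" where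
  "f - g = f + (- g)" for f g :: symfun

lift_definition times_symfun :: "symfun \<Rightarrow> symfun \<Rightarrow> symfun" is cauchy_prod
  by (auto intro: symmetric_series_cauchy_prod bounded_degree_cauchy_prod)

instance
proof
  fix a b c :: symfun
  show "a + b + c = a + (b + c)" by transfer (simp add: add.assoc)
  show "a + b = b + a" by transfer (simp add: add.commute)
  show "0 + a = a" by transfer simp
  show "- a + a = 0" by transfer simp
  show "a - b = a + - b" by (rule minus_symfun_def)
  show "a * b * c = a * (b * c)" by transfer (rule cauchy_prod_assoc)
  show "a * b = b * a" by transfer (rule cauchy_prod_commute)
  show "1 * a = a" by transfer (rule cauchy_prod_one)
  show "(a + b) * c = a * c + b * c" by transfer (rule cauchy_prod_add)
  show "(0::symfun) \<noteq> 1" by transfer (auto simp: fun_eq_iff)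
qed

end

lift_definition scale_sf :: "complex \<Rightarrow> symfun \<Rightarrow> symfun" is "\<lambda>c f m. c * f m"
  by (auto simp: symmetric_series_def bounded_degree_def)

interpretation symfun: vector_space scale_sf
  by unfold_locales (transfer; simp add: algebra_simps)+


section \<open>Partitions and the Kingman graph\<close>

definition is_partition :: "nat list \<Rightarrow> bool" where
  "is_partition \<mu> \<longleftrightarrow> sorted_wrt (\<ge>) \<mu> \<and> 0 \<notin> set \<mu>"

text \<open>Rows and columns of boxes are counted from 1, list positions from 0.\<close>

definition boxes :: "nat list \<Rightarrow> (nat \<times> nat) set" where
  "boxes \<mu> = {(i, j). 1 \<le> i \<and> i \<le> length \<mu> \<and> 1 \<le> j \<and> j \<le> \<mu> ! (i - 1)}"

definition covers :: "nat list \<Rightarrow> nat list \<Rightarrow> bool"  (infix \<open>\<searrow>\<close> 50) where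
  "\<nu> \<searrow> \<mu> \<longleftrightarrow> (\<exists>b. b \<notin> boxes \<mu> \<and> boxes \<nu> = insert b (boxes \<mu>))"

definition kingman_mult :: "nat list \<Rightarrow> nat list \<Rightarrow> nat" where
  "kingman_mult \<mu> \<nu> =
     (let (i, j) = the_elem (boxes \<nu> - boxes \<mu>) in count_list \<nu> (\<nu> ! (i - 1)))"

definition kingman_harmonic :: "(nat list \<Rightarrow> complex) \<Rightarrow> bool" where
  "kingman_harmonic \<phi> \<longleftrightarrow>
     (\<forall>\<mu>. is_partition \<mu> \<longrightarrow>
        \<phi> \<mu> = (\<Sum>\<nu> | is_partition \<nu> \<and> \<nu> \<searrow> \<mu>. of_nat (kingman_mult \<mu> \<nu>) * \<phi> \<nu>))"


section \<open>Factorial monomial symmetric functions\<close>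

definition pvar :: "nat \<Rightarrow> monom \<Rightarrow>\<^sub>0 complex" where
  "pvar i = Poly_Mapping.single (Poly_Mapping.single i 1) 1"

text \<open>
  The expression obtained from \<open>\<Prod>i<l. x i (x i - 1) \<dots> (x i - \<mu> i + 1)\<close> by permuting the
  variables with \<open>p\<close>, as a polynomial.
\<close>

definition factorial_expr :: "nat list \<Rightarrow> (nat \<Rightarrow> nat) \<Rightarrow> monom \<Rightarrow>\<^sub>0 complex" where
  "factorial_expr \<mu> p = (\<Prod>i<length \<mu>. \<Prod>k<\<mu> ! i. (pvar (p i) - of_nat k))"

definition factorial_exprs :: "nat list \<Rightarrow> (monom \<Rightarrow>\<^sub>0 complex) set" where
  "factorial_exprs \<mu> = {factorial_expr \<mu> p | p. bij p}"

text \<open>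
  For a nonempty partition there are infinitely many distinct expressions, but each monomial occurs
  in only finitely many of them (every expression is divisible by all of its variables), so that
  they are summed coefficientwise.
\<close>

definition factorial_monom_coeff :: "nat list \<Rightarrow> monom \<Rightarrow> complex" where
  "factorial_monom_coeff \<mu> m =
     (\<Sum>F | F \<in> factorial_exprs \<mu> \<and> Poly_Mapping.lookup F m \<noteq> 0. Poly_Mapping.lookup F m)"

lemma lookup_times_splits:
  "Poly_Mapping.lookup (F * G) m =
     (\<Sum>(a, b)\<in>{(a, b). a + b = m}. Poly_Mapping.lookup F a * Poly_Mapping.lookup G b)"
  for F G :: "monom \<Rightarrow>\<^sub>0 complex"
proof -
  have "Poly_Mapping.lookup (F * G) m =
      (\<Sum>(a, b). Poly_Mapping.lookup F a * Poly_Mapping.lookup G b when m = a + b)"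
    by transfer (rule prod_fun_unfold_prod)
  also have "\<dots> = (\<Sum>(a, b)\<in>{(a, b). a + b = m}.
      Poly_Mapping.lookup F a * Poly_Mapping.lookup G b when m = a + b)"
    by (rule Sum_any.expand_superset) (auto simp: finite_splits)
  also have "\<dots> = (\<Sum>(a, b)\<in>{(a, b). a + b = m}. Poly_Mapping.lookup F a * Poly_Mapping.lookup G b)"
    by (rule sum.cong) auto
  finally show ?thesis .
qed

lemma lookup_times_permute:
  fixes F F' G G' :: "monom \<Rightarrow>\<^sub>0 complex"
  assumes q: "bij q"
    and F: "\<And>m. Poly_Mapping.lookup F' m = Poly_Mapping.lookup F (Poly_Mapping.map_key q m)"
    and G: "\<And>m. Poly_Mapping.lookup G' m = Poly_Mapping.lookup G (Poly_Mapping.map_key q m)"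
  shows "Poly_Mapping.lookup (F' * G') m = Poly_Mapping.lookup (F * G) (Poly_Mapping.map_key q m)"
proof -
  note i = bij_is_inj[OF q] bij_is_inj[OF bij_imp_bij_inv[OF q]]
  show ?thesis
    unfolding lookup_times_splits F G
    by (rule sum.reindex_bij_witness[where
          j = "map_prod (Poly_Mapping.map_key q) (Poly_Mapping.map_key q)" and
          i = "map_prod (Poly_Mapping.map_key (inv q)) (Poly_Mapping.map_key (inv q))"])
      (use q in \<open>auto simp: map_key_inv map_key_plus[symmetric] i\<close>)
qed

lemma lookup_prod_permute:
  fixes F F' :: "'a \<Rightarrow> monom \<Rightarrow>\<^sub>0 complex"
  assumes q: "bij q" and "finite A"
    and F: "\<And>k m. k \<in> A \<Longrightarrow>
      Poly_Mapping.lookup (F' k) m = Poly_Mapping.lookup (F k) (Poly_Mapping.map_key q m)"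
  shows "Poly_Mapping.lookup (\<Prod>k\<in>A. F' k) m =
    Poly_Mapping.lookup (\<Prod>k\<in>A. F k) (Poly_Mapping.map_key q m)"
  using \<open>finite A\<close> F
proof (induction A arbitrary: m)
  case empty
  have "Poly_Mapping.map_key q m = 0 \<longleftrightarrow> m = 0"
    using map_key_inv[OF q, of m] q by (metis map_key_zero bij_is_inj bij_imp_bij_inv)
  then show ?case by (simp add: lookup_one when_def)
next
  case (insert k A)
  then show ?case
    by (simp add: lookup_times_permute[OF q])
qed

lemma lookup_of_nat_monom:
  "Poly_Mapping.lookup (of_nat k :: monom \<Rightarrow>\<^sub>0 complex) m = (if m = 0 then of_nat k else 0)"
  by (simp add: lookup_of_nat when_def)

lemma lookup_factorial_expr_permute:
  assumes q: "bij q"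
  shows "Poly_Mapping.lookup (factorial_expr \<mu> p) (Poly_Mapping.map_key q m) =
    Poly_Mapping.lookup (factorial_expr \<mu> (q \<circ> p)) m"
proof -
  have 0: "Poly_Mapping.map_key q m = 0 \<longleftrightarrow> m = 0" for m :: monom
    using map_key_inv[OF q, of m] q by (metis map_key_zero bij_is_inj bij_imp_bij_inv)
  have 1: "Poly_Mapping.map_key q m = Poly_Mapping.single i (Suc 0) \<longleftrightarrow> m = Poly_Mapping.single (q i) (Suc 0)"
    for m :: monom and i
    by (metis map_key_single[OF bij_is_inj[OF q]] map_key_inv(2)[OF q])
  show ?thesis
    unfolding factorial_expr_def
    by (rule sym, intro lookup_prod_permute q finite_lessThan)
      (auto simp: lookup_minus pvar_def lookup_single when_def lookup_of_nat_monom 0 1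
        eq_commute[of "Poly_Mapping.single _ _"])
qed

lemma lookup_prod_mdeg:
  fixes F :: "'a \<Rightarrow> monom \<Rightarrow>\<^sub>0 complex"
  assumes "finite A" "\<And>k m. k \<in> A \<Longrightarrow> Poly_Mapping.lookup (F k) m \<noteq> 0 \<Longrightarrow> mdeg m \<le> d k"
    and "Poly_Mapping.lookup (\<Prod>k\<in>A. F k) m \<noteq> 0"
  shows "mdeg m \<le> (\<Sum>k\<in>A. d k)"
  using assms
proof (induction A arbitrary: m)
  case empty
  then show ?case by (simp add: lookup_one when_def split: if_splits)
next
  case (insert k A)
  from insert.prems(2) insert.hyps have "Poly_Mapping.lookup (F k * (\<Prod>k\<in>A. F k)) m \<noteq> 0"
    by simp
  then obtain a b where ab: "a + b = m"
    "Poly_Mapping.lookup (F k) a * Poly_Mapping.lookup (\<Prod>k\<in>A. F k) b \<noteq> 0"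
    unfolding lookup_times_splits by (auto elim!: sum.not_neutral_contains_not_neutral)
  have "mdeg a \<le> d k" "mdeg b \<le> (\<Sum>k\<in>A. d k)"
    using ab insert by auto
  then show ?case
    using ab mdeg_add[of a b] insert.hyps by simp
qed

lemma lookup_factorial_expr_mdeg:
  assumes "Poly_Mapping.lookup (factorial_expr \<mu> p) m \<noteq> 0"
  shows "mdeg m \<le> (\<Sum>i<length \<mu>. \<Sum>k<\<mu> ! i. 1)"
proof -
  have "mdeg m \<le> 1" if "Poly_Mapping.lookup (pvar i - of_nat k) m \<noteq> 0" for i k m
    using that by (auto simp: lookup_minus pvar_def lookup_single when_def lookup_of_nat_monom
        mdeg_single split: if_splits)
  then show ?thesis
    using assms unfolding factorial_expr_def
    by (intro lookup_prod_mdeg[OF finite_lessThan]) (auto intro!: lookup_prod_mdeg[OF finite_lessThan])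
qed

lift_definition factorial_monom_sf :: "nat list \<Rightarrow> symfun" is factorial_monom_coeff
proof
  fix \<mu> :: "nat list"
  show "bounded_degree (factorial_monom_coeff \<mu>)"
    unfolding bounded_degree_def
  proof (intro exI allI impI)
    fix m
    assume "factorial_monom_coeff \<mu> m \<noteq> 0"
    then obtain p where "Poly_Mapping.lookup (factorial_expr \<mu> p) m \<noteq> 0"
      unfolding factorial_monom_coeff_def
      by (auto simp: factorial_exprs_def elim!: sum.not_neutral_contains_not_neutral)
    then show "mdeg m \<le> (\<Sum>i<length \<mu>. \<Sum>k<\<mu> ! i. 1)"
      by (rule lookup_factorial_expr_mdeg)
  qed
  show "symmetric_series (factorial_monom_coeff \<mu>)"
    unfolding symmetric_series_def
  proof safe
    fix q :: "nat \<Rightarrow> nat" and m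
    assume q: "bij q"
    let ?c = "Poly_Mapping.map_key q :: monom \<Rightarrow> monom"
    define act where "act r F = Poly_Mapping.map_key (Poly_Mapping.map_key r) F"
      for r :: "nat \<Rightarrow> nat" and F :: "monom \<Rightarrow>\<^sub>0 complex"
    have lookup_act: "Poly_Mapping.lookup (act r F) m = Poly_Mapping.lookup F (Poly_Mapping.map_key r m)"
      if "bij r" for r F m
      unfolding act_def by (rule lookup_map_key[OF bij_is_inj[OF bij_map_key[OF that]]])
    have act_expr: "act r (factorial_expr \<mu> p) = factorial_expr \<mu> (r \<circ> p)" if "bij r" for r p
      by (rule poly_mapping_eqI) (simp add: lookup_act[OF that] lookup_factorial_expr_permute[OF that])
    have act_in: "act r F \<in> factorial_exprs \<mu>" if "bij r" "F \<in> factorial_exprs \<mu>" for r F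
      using that by (auto simp: factorial_exprs_def act_expr intro: bij_comp)
    have act_inv: "act q (act (inv q) F) = F" "act (inv q) (act q F) = F" for F
      by (rule poly_mapping_eqI; simp add: lookup_act q bij_imp_bij_inv map_key_inv)+
    show "factorial_monom_coeff \<mu> (?c m) = factorial_monom_coeff \<mu> m"
      unfolding factorial_monom_coeff_def
      by (rule sum.reindex_bij_witness[where j = "act q" and i = "act (inv q)"])
        (use q in \<open>auto simp: act_inv act_in lookup_act bij_imp_bij_inv map_key_inv\<close>)
  qed
qed


section \<open>The functions under consideration\<close>

text \<open>Multiplicities \<open>r\<^sub>k(\<mu>) = 0\<close> contribute the factor \<open>0! = 1\<close> and are left out of the product.\<close>

definition fact_quot :: "nat list \<Rightarrow> complex" where
  "fact_quot \<mu> = (\<Prod>i<length \<mu>. fact (\<mu> ! i - 1)) / (\<Prod>k\<in>set \<mu>. fact (count_list \<mu> k))"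

definition box_prod :: "complex \<Rightarrow> nat list \<Rightarrow> complex" where
  "box_prod \<alpha> \<mu> = (\<Prod>(i, j) | (i, j) \<in> boxes \<mu> \<and> j \<ge> 2. 1 - \<alpha> / of_nat (j - 1))"

text \<open>
  For \<open>t = 0\<close> and a nonempty partition, the quotient \<open>t (t + \<alpha>) \<dots> (t + (l-1) \<alpha>) / (t)\<^sub>n\<close> has the
  form \<open>0 / 0\<close> and is understood after cancelling the common factor \<open>t\<close>.
\<close>

definition t_quot :: "complex \<Rightarrow> complex \<Rightarrow> nat \<Rightarrow> nat \<Rightarrow> complex" where
  "t_quot t \<alpha> l n =
     (if t = 0 \<and> n > 0 then (\<Prod>i=1..<l. t + of_nat i * \<alpha>) / pochhammer (t + 1) (n - 1)
      else (\<Prod>i<l. t + of_nat i * \<alpha>) / pochhammer t n)"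

lemma t_quot_cancelled:
  assumes "l > 0" "n > 0"
  shows "t_quot t \<alpha> l n = (\<Prod>i=1..<l. t + of_nat i * \<alpha>) / pochhammer (t + 1) (n - 1)"
proof (cases "t = 0")
  case False
  have "(\<Prod>i<l. t + of_nat i * \<alpha>) = t * (\<Prod>i=1..<l. t + of_nat i * \<alpha>)"
    using assms by (subst lessThan_atLeast0, subst prod.atLeast_Suc_lessThan) auto
  moreover have "pochhammer t n = t * pochhammer (t + 1) (n - 1)"
    using assms by (metis Suc_diff_1 pochhammer_rec)
  ultimately show ?thesis
    using False by (simp add: t_quot_def)
qed (use assms in \<open>simp add: t_quot_def\<close>)

definition kingman_phi :: "complex \<Rightarrow> complex \<Rightarrow> nat list \<Rightarrow> complex" where
  "kingman_phi t \<alpha> \<mu> = fact_quot \<mu> * t_quot t \<alpha> (length \<mu>) (sum_list \<mu>) * box_prod \<alpha> \<mu>"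

lemma kingman_phi_eq:
  assumes "t \<noteq> 0 \<or> \<mu> = []"
  shows "kingman_phi t \<alpha> \<mu> = fact_quot \<mu> *
    ((\<Prod>i<length \<mu>. t + of_nat i * \<alpha>) / pochhammer t (sum_list \<mu>)) * box_prod \<alpha> \<mu>"
  using assms by (auto simp: kingman_phi_def t_quot_def)

end

theory Submission
  imports Defs "HOL-Combinatorics.Multiset_Permutations" "HOL-Computational_Algebra.Polynomial"
    "HOL-Library.Infinite_Set"
begin

text \<open>
  The functional \<open>\<pi>\<close> is the specialization \<open>p\<^sub>k \<mapsto> - t \<alpha> ^ (k - 1)\<close> of the power sums. If
  \<open>t = - N \<alpha>\<close> with a natural number \<open>N\<close>, this is the evaluation at \<open>N\<close> variables equal to \<open>\<alpha>\<close>
  and all others zero, so that it is multiplicative and its value on a factorial monomial function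
  is found by counting the expressions that only involve the first \<open>N\<close> variables. For general
  \<open>t\<close>, grouping monomials by their support replaces \<open>N choose l\<close> by a polynomial in \<open>t / \<alpha>\<close>, and
  the factor \<open>\<alpha> ^ l\<close> clears its denominator. All identities are therefore polynomial in \<open>t\<close> and
  continuous in \<open>\<alpha>\<close>, and extend from \<open>t = - N \<alpha>\<close>, \<open>\<alpha> \<noteq> 0\<close>.

  For harmonicity, the multiplicity of an edge cancels the new factor of the denominator
  \<open>\<Prod>k. r\<^sub>k!\<close>. Hence lengthening a row of length \<open>k\<close> contributes \<open>r\<^sub>k(\<mu>) (k - \<alpha>) / (t + n)\<close>, a new
  row contributes \<open>(t + l \<alpha>) / (t + n)\<close>, and these numbers add up to \<open>1\<close>.
\<close>

section \<open>Weights of rows and multiplicities\<close>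

text \<open>The factorial and the box factors of one row combined: (1 - \<alpha>)(2 - \<alpha>)...(k
  - 1 - \<alpha>), a polynomial in \<alpha> without denominators.\<close>

definition row_weight :: "complex \<Rightarrow> nat \<Rightarrow> complex" where
  "row_weight \<alpha> k = (\<Prod>j=1..<k. of_nat j - \<alpha>)"

text \<open>The denominator of \<open>fact_quot\<close>, kept apart from the row weights because it
  is the only place where equal parts interact.\<close>

definition mult_fact :: "nat list \<Rightarrow> complex" where
  "mult_fact \<mu> = (\<Prod>k\<in>set \<mu>. fact (count_list \<mu> k))"

lemma row_weight_Suc: "k \<ge> 1 \<Longrightarrow> row_weight \<alpha> (Suc k) = row_weight \<alpha> k * (of_nat k - \<alpha>)"
  by (simp add: row_weight_def)

text \<open>Each factor j - 1 of the factorial absorbs the denominator of the box in column j and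
  leaves j - 1 - \<alpha>; hence the shift of the index range.\<close>

lemma row_weight_eq: "k \<ge> 1 \<Longrightarrow> fact (k - 1) * (\<Prod>j=2..k. 1 - \<alpha> / of_nat (j - 1)) = row_weight \<alpha> k"
proof (induction k rule: dec_induct)
  case (step k)
  then have "of_nat k \<noteq> (0::complex)" "fact k = (of_nat k * fact (k - 1) :: complex)"
    by (auto simp: fact_reduce)
  moreover have "(\<Prod>j=2..Suc k. 1 - \<alpha> / of_nat (j - 1)) =
      (\<Prod>j=2..k. 1 - \<alpha> / of_nat (j - 1)) * (1 - \<alpha> / of_nat k)"
    using step by (subst prod.nat_ivl_Suc') auto
  ultimately have "fact (Suc k - 1) * (\<Prod>j=2..Suc k. 1 - \<alpha> / of_nat (j - 1)) =
    (fact (k - 1) * (\<Prod>j=2..k. 1 - \<alpha> / of_nat (j - 1))) * (of_nat k * (1 - \<alpha> / of_nat k))"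
    by simp
  also have "of_nat k * (1 - \<alpha> / of_nat k) = of_nat k - \<alpha>"
    using \<open>of_nat k \<noteq> (0::complex)\<close> by (simp add: field_simps)
  finally show ?case
    using step by (simp only: row_weight_Suc)
qed (simp add: row_weight_def)

lemma box_prod_rows: "box_prod \<alpha> \<mu> = (\<Prod>i<length \<mu>. \<Prod>j=2..\<mu> ! i. 1 - \<alpha> / of_nat (j - 1))"
proof -
  have "(\<Prod>i<length \<mu>. \<Prod>j=2..\<mu> ! i. 1 - \<alpha> / of_nat (j - 1)) =
      (\<Prod>(i, j)\<in>Sigma {..<length \<mu>} (\<lambda>i. {2..\<mu> ! i}). 1 - \<alpha> / of_nat (j - 1))"
    by (subst prod.Sigma) auto
  also have "\<dots> = box_prod \<alpha> \<mu>"
    unfolding box_prod_def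
    by (rule prod.reindex_bij_witness[where i = "\<lambda>(i, j). (i - 1, j)" and j = "\<lambda>(i, j). (i + 1, j)"])
      (auto simp: boxes_def)
  finally show ?thesis ..
qed

lemma fact_quot_box_prod:
  assumes "0 \<notin> set \<mu>"
  shows "fact_quot \<mu> * box_prod \<alpha> \<mu> = prod_list (map (row_weight \<alpha>) \<mu>) / mult_fact \<mu>"
proof -
  have "fact_quot \<mu> * box_prod \<alpha> \<mu> =
      (\<Prod>i<length \<mu>. fact (\<mu> ! i - 1) * (\<Prod>j=2..\<mu> ! i. 1 - \<alpha> / of_nat (j - 1))) / mult_fact \<mu>"
    by (simp add: fact_quot_def box_prod_rows mult_fact_def prod.distrib)
  also have "(\<Prod>i<length \<mu>. fact (\<mu> ! i - 1) * (\<Prod>j=2..\<mu> ! i. 1 - \<alpha> / of_nat (j - 1))) =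
      (\<Prod>i<length \<mu>. row_weight \<alpha> (\<mu> ! i))"
    by (intro prod.cong row_weight_eq) (use assms in \<open>auto simp: Suc_le_eq in_set_conv_nth intro!: Nat.gr0I\<close>)
  also have "\<dots> = prod_list (map (row_weight \<alpha>) \<mu>)"
    by (simp add: prod.list_conv_set_nth lessThan_atLeast0)
  finally show ?thesis .
qed

lemma mult_fact_nonzero [simp]: "mult_fact \<mu> \<noteq> 0"
  by (simp add: mult_fact_def)

lemma mult_fact_superset:
  assumes "finite A" "set \<mu> \<subseteq> A"
  shows "mult_fact \<mu> = (\<Prod>k\<in>A. fact (count_list \<mu> k))"
  unfolding mult_fact_def using assms
  by (intro prod.mono_neutral_left) (auto simp: count_list_0_iff)

text \<open>Only the factor of k changes, from r! to (r + 1)!. The quotient r + 1 is what an edge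
  multiplicity cancels later.\<close>

lemma mult_fact_Cons: "mult_fact (k # \<mu>) = of_nat (count_list \<mu> k + 1) * mult_fact \<mu>"
proof -
  let ?A = "insert k (set \<mu>)"
  have "mult_fact (k # \<mu>) = (\<Prod>x\<in>?A. fact (count_list (k # \<mu>) x))"
    by (rule mult_fact_superset) auto
  also have "\<dots> = fact (count_list \<mu> k + 1) * (\<Prod>x\<in>?A - {k}. fact (count_list \<mu> x))"
    by (subst prod.remove[of _ k]) auto
  also have "\<dots> = of_nat (count_list \<mu> k + 1) * (\<Prod>x\<in>?A. fact (count_list \<mu> x))"
    by (subst (2) prod.remove[of _ k]) auto
  also have "(\<Prod>x\<in>?A. fact (count_list \<mu> x)) = mult_fact \<mu>"
    by (rule mult_fact_superset[symmetric]) auto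
  finally show ?thesis .
qed

lemma mult_fact_mset: "mult_fact \<mu> = (\<Prod>k\<in>set_mset (mset \<mu>). fact (count (mset \<mu>) k))"
  by (simp add: mult_fact_def count_mset)

lemma mult_fact_cong: "mset \<mu> = mset \<nu> \<Longrightarrow> mult_fact \<mu> = mult_fact \<nu>"
  by (simp only: mult_fact_mset)

lemma count_list_cong: "mset \<mu> = mset \<nu> \<Longrightarrow> count_list \<mu> k = count_list \<nu> k"
  by (metis count_mset)


section \<open>Harmonicity\<close>

lemma mem_boxes:
  "(i, j) \<in> boxes \<mu> \<longleftrightarrow> 1 \<le> i \<and> i \<le> length \<mu> \<and> 1 \<le> j \<and> j \<le> \<mu> ! (i - 1)"
  by (simp add: boxes_def)

lemma boxes_append_one: "boxes (\<mu> @ [1]) = insert (length \<mu> + 1, 1) (boxes \<mu>)"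
  by (auto simp: boxes_def nth_append split: if_splits)

lemma boxes_increment:
  assumes "i < length \<mu>"
  shows "boxes (\<mu>[i := \<mu> ! i + 1]) = insert (i + 1, \<mu> ! i + 1) (boxes \<mu>)"
  using assms by (auto simp: boxes_def nth_list_update split: if_splits)

lemma is_partition_nth_mono:
  "is_partition \<mu> \<Longrightarrow> i \<le> j \<Longrightarrow> j < length \<mu> \<Longrightarrow> \<mu> ! j \<le> \<mu> ! i"
  unfolding is_partition_def by (cases "i = j") (auto simp: sorted_wrt_iff_nth_less)

lemma is_partition_nth_pos: "is_partition \<mu> \<Longrightarrow> i < length \<mu> \<Longrightarrow> 1 \<le> \<mu> ! i"
  unfolding is_partition_def by (metis One_nat_def Suc_leI neq0_conv nth_mem)

text \<open>Picks the topmost row of each length: lengthening a lower row of the same length would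
  break the order. The new row at the bottom is treated separately.\<close>

definition inner_corners :: "nat list \<Rightarrow> nat set" where
  "inner_corners \<mu> = {i. i < length \<mu> \<and> (\<forall>j<i. \<mu> ! j > \<mu> ! i)}"

lemma is_partition_increment:
  assumes "is_partition \<mu>" "i < length \<mu>"
  shows "is_partition (\<mu>[i := \<mu> ! i + 1]) \<longleftrightarrow> i \<in> inner_corners \<mu>"
proof
  assume p: "is_partition (\<mu>[i := \<mu> ! i + 1])"
  have "\<mu> ! j > \<mu> ! i" if "j < i" for j
    using is_partition_nth_mono[OF p, of j i] that assms by simp
  then show "i \<in> inner_corners \<mu>"
    using assms by (simp add: inner_corners_def)
next
  assume c: "i \<in> inner_corners \<mu>"
  have "\<mu>[i := \<mu> ! i + 1] ! k \<le> \<mu>[i := \<mu> ! i + 1] ! j" if "j < k" "k < length \<mu>" for j k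
    using that c is_partition_nth_mono[OF assms(1), of j k]
    by (auto simp: nth_list_update inner_corners_def Suc_le_eq)
  moreover have "0 \<notin> set (\<mu>[i := \<mu> ! i + 1])"
    using assms(1) set_update_subset_insert[of \<mu> i "\<mu> ! i + 1"] by (auto simp: is_partition_def)
  ultimately show "is_partition (\<mu>[i := \<mu> ! i + 1])"
    by (simp add: is_partition_def sorted_wrt_iff_nth_less)
qed

lemma is_partition_append_one: "is_partition \<mu> \<Longrightarrow> is_partition (\<mu> @ [1])"
  by (auto simp: is_partition_def sorted_wrt_append Suc_le_eq intro: gr0I)

text \<open>A row is determined by its set of columns, so all rows without the new box agree. If the
  row of the new box already exists, it grows by one at its end; otherwise it is the next row and
  has length 1.\<close>

lemma covers_cases:
  assumes \<mu>: "is_partition \<mu>" and \<nu>: "is_partition \<nu>" and "\<nu> \<searrow> \<mu>"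
  shows "\<nu> = \<mu> @ [1] \<or> (\<exists>i<length \<mu>. \<nu> = \<mu>[i := \<mu> ! i + 1])"
proof -
  obtain a c where b: "(a, c) \<notin> boxes \<mu>" and eq: "boxes \<nu> = insert (a, c) (boxes \<mu>)"
    using \<open>\<nu> \<searrow> \<mu>\<close> unfolding covers_def by auto
  have nu_iff: "(i, j) \<in> boxes \<nu> \<longleftrightarrow> (i = a \<and> j = c) \<or> (i, j) \<in> boxes \<mu>" for i j
    using eq by auto
  \<comment> \<open>Parts are positive, so the number of rows can be read off the first
    column.\<close>
  have first_box: "i < length \<kappa> \<longleftrightarrow> (i + 1, 1) \<in> boxes \<kappa>" if "is_partition \<kappa>" for i \<kappa>
    using is_partition_nth_pos[OF that, of i] by (auto simp: mem_boxes)
  have other_row: "\<nu> ! i = \<mu> ! i" if "i < length \<mu>" "i + 1 \<noteq> a" for i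
  proof -
    have "i < length \<nu>"
      using that first_box[OF \<mu>, of i] first_box[OF \<nu>, of i] nu_iff[of "i + 1" 1] by auto
    then have "j \<le> \<nu> ! i \<longleftrightarrow> j \<le> \<mu> ! i" if "1 \<le> j" for j
      using nu_iff[of "i + 1" j] \<open>i + 1 \<noteq> a\<close> \<open>i < length \<mu>\<close> that by (simp add: mem_boxes)
    then show ?thesis
      using is_partition_nth_pos[OF \<mu>, of i] is_partition_nth_pos[OF \<nu>, of i] that \<open>i < length \<nu>\<close>
      by (metis order_antisym order_refl)
  qed
  have ac: "1 \<le> a" "a \<le> length \<nu>" "1 \<le> c" "c \<le> \<nu> ! (a - 1)"
    using nu_iff[of a c] by (auto simp: mem_boxes)
  show ?thesis
  proof (cases "a \<le> length \<mu>")
    case True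
    have len: "length \<nu> = length \<mu>"
    proof -
      have "i < length \<nu> \<longleftrightarrow> i < length \<mu>" for i
        using first_box[OF \<mu>, of i] first_box[OF \<nu>, of i] nu_iff[of "i + 1" 1] True by auto
      then show ?thesis
        by (metis linorder_neqE_nat less_irrefl)
    qed
    have "j \<le> \<nu> ! (a - 1) \<longleftrightarrow> j = c \<or> j \<le> \<mu> ! (a - 1)" if "1 \<le> j" for j
      using nu_iff[of a j] True ac that len by (auto simp: mem_boxes)
    then have row: "j \<le> \<nu> ! (a - 1) \<longleftrightarrow> j = c \<or> j \<le> \<mu> ! (a - 1)" for j
      using ac by (cases "j = 0") auto
    have "c > \<mu> ! (a - 1)"
      using b True ac by (auto simp: mem_boxes)
    \<comment> \<open>If m is the old row length, the columns {1..m} together with some c > m form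
      an initial segment only for c = m + 1.\<close>
    with row[of "\<nu> ! (a - 1)"] row[of "\<mu> ! (a - 1) + 1"] row[of c] row[of "\<mu> ! (a - 1)"]
      row[of "c - 1"]
    have "\<nu> ! (a - 1) = \<mu> ! (a - 1) + 1"
      by auto
    then have "\<nu> = \<mu>[a - 1 := \<mu> ! (a - 1) + 1]"
      using other_row True ac len
      by (intro nth_equalityI) (auto simp: nth_list_update)
    then show ?thesis
      using True ac by (metis Suc_diff_1 Suc_le_lessD less_le_trans zero_less_one One_nat_def Suc_le_eq)
  next
    case False
    have "i < length \<nu> \<longleftrightarrow> i < length \<mu> \<or> i + 1 = a" for i
      using first_box[OF \<mu>, of i] first_box[OF \<nu>, of i] nu_iff[of "i + 1" 1] False ac
      by (auto simp: mem_boxes)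
    then have len: "i < length \<nu> \<longleftrightarrow> i < length \<mu> \<or> i + 1 = a" for i .
    have "\<not> length \<mu> + 1 < a"
      using len[of "length \<mu>"] len[of "a - 1"] by auto
    then have a: "a = length \<mu> + 1"
      using False by simp
    have ln: "length \<nu> = length \<mu> + 1"
      using len[of "length \<mu>"] len[of "length \<mu> + 1"] a by auto
    have row: "(j \<le> \<nu> ! length \<mu>) \<longleftrightarrow> j = c" if "1 \<le> j" for j
      using nu_iff[of a j] that a ln by (auto simp: mem_boxes)
    have "\<nu> ! length \<mu> = 1"
      using row[of 1] row[of 2] row[of "\<nu> ! length \<mu>"] is_partition_nth_pos[OF \<nu>, of "length \<mu>"] ln by auto
    then have "\<nu> = \<mu> @ [1]"
      using other_row ln a by (intro nth_equalityI) (auto simp: nth_append less_Suc_eq)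
    then show ?thesis ..
  qed
qed

lemma partitions_covering:
  assumes "is_partition \<mu>"
  shows "{\<nu>. is_partition \<nu> \<and> \<nu> \<searrow> \<mu>} =
    insert (\<mu> @ [1]) ((\<lambda>i. \<mu>[i := \<mu> ! i + 1]) ` inner_corners \<mu>)"
proof -
  have "\<mu> @ [1] \<searrow> \<mu>"
    unfolding covers_def by (rule exI[of _ "(length \<mu> + 1, 1)"]) (use boxes_append_one in \<open>auto simp: mem_boxes\<close>)
  moreover have "\<mu>[i := \<mu> ! i + 1] \<searrow> \<mu>" if "i < length \<mu>" for i
    unfolding covers_def
    by (rule exI[of _ "(i + 1, \<mu> ! i + 1)"]) (use boxes_increment[OF that] in \<open>auto simp: mem_boxes\<close>)
  ultimately show ?thesis
    using covers_cases[OF assms] is_partition_increment[OF assms] is_partition_append_one[OF assms]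
    by (auto simp: inner_corners_def) blast+
qed

text \<open>Turns a sum over corners into a sum over the distinct part sizes. The corner for k is
  the first row of length k: earlier rows are at least as long by monotonicity and differ from k by
  minimality.\<close>

lemma bij_betw_inner_corners:
  assumes "is_partition \<mu>"
  shows "bij_betw (\<lambda>i. \<mu> ! i) (inner_corners \<mu>) (set \<mu>)"
  unfolding bij_betw_def
proof
  show "inj_on (\<lambda>i. \<mu> ! i) (inner_corners \<mu>)"
    by (rule linorder_inj_onI') (auto simp: inner_corners_def)
  have "\<exists>i\<in>inner_corners \<mu>. k = \<mu> ! i" if "k \<in> set \<mu>" for k
  proof -
    define i where "i = (LEAST i. i < length \<mu> \<and> \<mu> ! i = k)"
    have i: "i < length \<mu> \<and> \<mu> ! i = k"
      using that unfolding i_def in_set_conv_nth by (elim exE) (rule LeastI)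
    have "\<mu> ! j > \<mu> ! i" if "j < i" for j
    proof -
      have "\<mu> ! j \<noteq> k"
        using not_less_Least[of j "\<lambda>i. i < length \<mu> \<and> \<mu> ! i = k"] that i unfolding i_def by auto
      moreover have "\<mu> ! i \<le> \<mu> ! j"
        using is_partition_nth_mono[OF assms, of j i] that i by simp
      ultimately show ?thesis
        using i by simp
    qed
    then have "i \<in> inner_corners \<mu>"
      using i by (simp add: inner_corners_def)
    with i show ?thesis by auto
  qed
  then show "(\<lambda>i. \<mu> ! i) ` inner_corners \<mu> = set \<mu>"
    by (auto simp: inner_corners_def)
qed

section \<open>Edge multiplicities and the change of \<open>kingman_phi\<close> along an
  edge\<close>

lemma kingman_mult_append_one: "kingman_mult \<mu> (\<mu> @ [1]) = count_list \<mu> 1 + 1"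
proof -
  have "boxes (\<mu> @ [1]) - boxes \<mu> = {(length \<mu> + 1, 1)}"
    using boxes_append_one by (auto simp: mem_boxes)
  then show ?thesis
    by (simp add: kingman_mult_def)
qed

lemma kingman_mult_increment:
  assumes "i < length \<mu>"
  shows "kingman_mult \<mu> (\<mu>[i := \<mu> ! i + 1]) = count_list (\<mu>[i := \<mu> ! i + 1]) (\<mu> ! i + 1)"
proof -
  have "boxes (\<mu>[i := \<mu> ! i + 1]) - boxes \<mu> = {(i + 1, \<mu> ! i + 1)}"
    using boxes_increment[OF assms] by (auto simp: mem_boxes)
  then show ?thesis
    using assms by (simp add: kingman_mult_def)
qed

lemma kingman_phi_partition:
  "is_partition \<mu> \<Longrightarrow> kingman_phi t \<alpha> \<mu> =
    prod_list (map (row_weight \<alpha>) \<mu>) / mult_fact \<mu> * t_quot t \<alpha> (length \<mu>) (sum_list \<mu>)"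
  by (simp add: kingman_phi_def is_partition_def flip: fact_quot_box_prod)

text \<open>The cancelled form of \<open>t_quot\<close> treats t = 0 like every other value; passing
  from n to n + 1 only appends the factor t + n to the denominator.\<close>

lemma t_quot_Suc:
  assumes "l > 0" "n > 0" "t + of_nat n \<noteq> 0"
  shows "t_quot t \<alpha> l (Suc n) = t_quot t \<alpha> l n / (t + of_nat n)"
proof -
  obtain m where "n = Suc m"
    using assms(2) gr0_implies_Suc by blast
  then have "pochhammer (t + 1) n = pochhammer (t + 1) (n - 1) * (t + of_nat n)"
    by (simp add: pochhammer_Suc algebra_simps)
  then show ?thesis
    using assms by (simp add: t_quot_cancelled)
qed

lemma t_quot_Suc_Suc:
  assumes "l > 0" "n > 0" "t + of_nat n \<noteq> 0"
  shows "t_quot t \<alpha> (Suc l) (Suc n) = t_quot t \<alpha> l n * (t + of_nat l * \<alpha>) / (t + of_nat n)"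
proof -
  have "t_quot t \<alpha> (Suc l) (Suc n) = t_quot t \<alpha> l (Suc n) * (t + of_nat l * \<alpha>)"
    using assms by (simp add: t_quot_cancelled)
  then show ?thesis
    using assms by (simp add: t_quot_Suc)
qed

text \<open>A row of length 1 has weight 1, and the edge multiplicity r_1(\<mu>) + 1 cancels in
  \<open>mult_fact\<close>, so that only the quotient of the two \<open>t_quot\<close> values
  remains.\<close>

lemma kingman_phi_append_one:
  assumes \<mu>: "is_partition \<mu>" "\<mu> \<noteq> []" and t: "t + of_nat (sum_list \<mu>) \<noteq> 0"
  shows "of_nat (kingman_mult \<mu> (\<mu> @ [1])) * kingman_phi t \<alpha> (\<mu> @ [1]) =
    kingman_phi t \<alpha> \<mu> * ((t + of_nat (length \<mu>) * \<alpha>) / (t + of_nat (sum_list \<mu>)))"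
proof -
  have "sum_list \<mu> > 0"
    using \<mu> by (cases \<mu>) (auto simp: is_partition_def)
  moreover have "mult_fact (\<mu> @ [1]) = of_nat (count_list \<mu> 1 + 1) * mult_fact \<mu>"
    unfolding mult_fact_Cons[symmetric] by (rule mult_fact_cong) simp
  moreover have "of_nat (count_list \<mu> 1 + 1) \<noteq> (0::complex)"
    unfolding of_nat_eq_0_iff by simp
  ultimately show ?thesis
    using \<mu> t by (simp add: kingman_phi_partition is_partition_append_one[simplified] kingman_mult_append_one[simplified] t_quot_Suc_Suc
        row_weight_def del: of_nat_add of_nat_Suc)
qed

text \<open>As multisets of parts, \<mu> is k added to \<rho> and \<nu> is k + 1 added to \<rho>, so
  both values are expressed through \<rho>. In \<open>mult_fact\<close> the edge multiplicity
  cancels and r_k(\<mu>) is left over; the row weights have the ratio k - \<alpha>.\<close>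

lemma kingman_phi_increment:
  assumes \<mu>: "is_partition \<mu>" and i: "i \<in> inner_corners \<mu>" and t: "t + of_nat (sum_list \<mu>) \<noteq> 0"
  defines "\<nu> \<equiv> \<mu>[i := \<mu> ! i + 1]"
  shows "of_nat (kingman_mult \<mu> \<nu>) * kingman_phi t \<alpha> \<nu> =
    kingman_phi t \<alpha> \<mu> * (of_nat (count_list \<mu> (\<mu> ! i)) * (of_nat (\<mu> ! i) - \<alpha>) / (t + of_nat (sum_list \<mu>)))"
proof -
  have il: "i < length \<mu>"
    using i by (simp add: inner_corners_def)
  have \<nu>: "is_partition \<nu>"
    unfolding \<nu>_def using is_partition_increment[OF \<mu> il] i by blast
  define k where "k = \<mu> ! i"
  define \<rho> where "\<rho> = take i \<mu> @ drop (Suc i) \<mu>"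
  have \<mu>_eq: "mset \<mu> = mset (k # \<rho>)"
    unfolding k_def \<rho>_def by (subst id_take_nth_drop[OF il]) simp
  have \<nu>_eq: "mset \<nu> = mset ((k + 1) # \<rho>)"
    unfolding \<nu>_def k_def \<rho>_def by (subst upd_conv_take_nth_drop[OF il]) simp
  have k: "k \<ge> 1"
    unfolding k_def by (rule is_partition_nth_pos[OF \<mu> il])
  have sum: "sum_list \<mu> = k + sum_list \<rho>" "sum_list \<nu> = k + 1 + sum_list \<rho>"
    using \<mu>_eq \<nu>_eq by (metis sum_list.Cons sum_mset_sum_list)+
  have prod: "prod_list (map (row_weight \<alpha>) \<mu>) = row_weight \<alpha> k * prod_list (map (row_weight \<alpha>) \<rho>)"
    "prod_list (map (row_weight \<alpha>) \<nu>) = row_weight \<alpha> (k + 1) * prod_list (map (row_weight \<alpha>) \<rho>)"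
    using arg_cong[OF \<mu>_eq, of "\<lambda>M. prod_mset (image_mset (row_weight \<alpha>) M)"]
      arg_cong[OF \<nu>_eq, of "\<lambda>M. prod_mset (image_mset (row_weight \<alpha>) M)"]
    by (simp_all flip: prod_mset_prod_list)
  have cnt: "count_list \<mu> k = count_list \<rho> k + 1" "kingman_mult \<mu> \<nu> = count_list \<rho> (k + 1) + 1"
    using count_list_cong[OF \<mu>_eq, of k] count_list_cong[OF \<nu>_eq, of "k + 1"]
      kingman_mult_increment[OF il] by (simp_all add: k_def \<nu>_def)
  have R: "mult_fact \<mu> = of_nat (count_list \<mu> k) * mult_fact \<rho>"
    "mult_fact \<nu> = of_nat (kingman_mult \<mu> \<nu>) * mult_fact \<rho>"
    using mult_fact_cong[OF \<mu>_eq] mult_fact_cong[OF \<nu>_eq] unfolding mult_fact_Cons cnt by simp_all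
  have nz: "of_nat (count_list \<mu> k) \<noteq> (0::complex)" "of_nat (kingman_mult \<mu> \<nu>) \<noteq> (0::complex)"
    unfolding cnt of_nat_eq_0_iff by simp_all
  have len: "length \<nu> = length \<mu>" "length \<mu> > 0"
    using il by (auto simp: \<nu>_def)
  have "t_quot t \<alpha> (length \<nu>) (sum_list \<nu>) = t_quot t \<alpha> (length \<mu>) (sum_list \<mu>) / (t + of_nat (sum_list \<mu>))"
    using t_quot_Suc[of "length \<mu>" "sum_list \<mu>" t \<alpha>] t k len sum by auto
  then show ?thesis
    unfolding kingman_phi_partition[OF \<mu>] kingman_phi_partition[OF \<nu>] prod R k_def[symmetric]
    using nz k row_weight_Suc[OF k, of \<alpha>] by simp
qed

lemma sum_count_list:
  fixes f :: "'a \<Rightarrow> complex"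
  assumes "finite A" "set xs \<subseteq> A"
  shows "(\<Sum>k\<in>A. of_nat (count_list xs k) * f k) = sum_list (map f xs)"
  using assms(2)
proof (induction xs)
  case (Cons x xs)
  have "(\<Sum>k\<in>A. of_nat (count_list (x # xs) k) * f k) =
      (\<Sum>k\<in>A. of_nat (count_list xs k) * f k + (if k = x then f k else 0))"
    by (intro sum.cong) (auto simp: algebra_simps)
  then show ?case
    using Cons assms(1) by (simp add: sum.distrib sum.delta add.commute)
qed simp

lemma kingman_harmonic_phi:
  fixes t \<alpha> :: complex
  assumes "\<forall>k::nat. k \<ge> 1 \<longrightarrow> t \<noteq> - of_nat k"
  shows "kingman_harmonic (kingman_phi t \<alpha>)"
  unfolding kingman_harmonic_def
proof (intro allI impI)
  fix \<mu> :: "nat list"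
  assume \<mu>: "is_partition \<mu>"
  let ?f = "\<lambda>\<nu>. of_nat (kingman_mult \<mu> \<nu>) * kingman_phi t \<alpha> \<nu>"
  let ?inc = "\<lambda>i. \<mu>[i := \<mu> ! i + 1]"
  have fin: "finite (inner_corners \<mu>)"
    by (rule finite_subset[of _ "{..<length \<mu>}"]) (auto simp: inner_corners_def)
  have inj: "inj_on ?inc (inner_corners \<mu>)"
  proof (rule inj_onI)
    fix i j
    assume i: "i \<in> inner_corners \<mu>" and "?inc i = ?inc j"
    then have "?inc i ! i = ?inc j ! i"
      by (elim arg_cong)
    moreover have "?inc i ! i = \<mu> ! i + 1"
      using i by (simp add: inner_corners_def)
    ultimately show "i = j"
      by (metis add_eq_self_zero nth_list_update_neq zero_neq_one)
  qed
  have new: "\<mu> @ [1] \<notin> ?inc ` inner_corners \<mu>"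
    by (auto dest: arg_cong[where f = length])
  have "(\<Sum>\<nu> | is_partition \<nu> \<and> \<nu> \<searrow> \<mu>. ?f \<nu>) = ?f (\<mu> @ [1]) + (\<Sum>i\<in>inner_corners \<mu>. ?f (?inc i))"
    unfolding partitions_covering[OF \<mu>] using fin inj new by (simp add: sum.reindex)
  also have "\<dots> = kingman_phi t \<alpha> \<mu>"
  proof (cases "\<mu> = []")
    \<comment> \<open>Only the one-box diagram covers the empty one. Its \<open>t_quot\<close> is t
      / t, which is 1 for t = 0 as well by the convention on cancelling.\<close>
    case True
    moreover have "is_partition []" "is_partition [1]"
      by (simp_all add: is_partition_def)
    ultimately show ?thesis
      using kingman_mult_append_one[of "[]"]
      by (simp add: kingman_phi_partition inner_corners_def mult_fact_def row_weight_def t_quot_def)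
  next
    case False
    let ?n = "sum_list \<mu>" and ?l = "length \<mu>"
    have "?n \<ge> 1"
      using \<mu> False by (cases \<mu>) (auto simp: is_partition_def)
    with assms have t: "t + of_nat ?n \<noteq> 0"
      by (metis eq_neg_iff_add_eq_0)
    \<comment> \<open>Counting each length k with its multiplicity gives a sum over all rows, namely
      n - l \<alpha>, which complements the t + l \<alpha> of the new row to t + n.\<close>
    have "(\<Sum>i\<in>inner_corners \<mu>. of_nat (count_list \<mu> (\<mu> ! i)) * (of_nat (\<mu> ! i) - \<alpha>)) =
        (\<Sum>k\<in>set \<mu>. of_nat (count_list \<mu> k) * (of_nat k - \<alpha>))"
      by (rule sum.reindex_bij_betw[OF bij_betw_inner_corners[OF \<mu>]])
    also have "\<dots> = sum_list (map (\<lambda>k. of_nat k - \<alpha>) \<mu>)"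
      by (rule sum_count_list) auto
    also have "\<dots> = of_nat ?n - of_nat ?l * \<alpha>"
      by (induction \<mu>) (simp_all add: algebra_simps)
    finally have S: "(\<Sum>i\<in>inner_corners \<mu>. of_nat (count_list \<mu> (\<mu> ! i)) * (of_nat (\<mu> ! i) - \<alpha>)) = \<dots>" .
    have "?f (\<mu> @ [1]) + (\<Sum>i\<in>inner_corners \<mu>. ?f (?inc i)) =
        kingman_phi t \<alpha> \<mu> * ((t + of_nat ?l * \<alpha>) / (t + of_nat ?n) +
          (\<Sum>i\<in>inner_corners \<mu>. of_nat (count_list \<mu> (\<mu> ! i)) * (of_nat (\<mu> ! i) - \<alpha>)) / (t + of_nat ?n))"
      unfolding kingman_phi_append_one[OF \<mu> False t] distrib_left sum_divide_distrib sum_distrib_left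
      by (intro arg_cong2[where f = "(+)"] sum.cong refl kingman_phi_increment[OF \<mu> _ t])
    then show ?thesis
      using t unfolding S by (simp flip: add_divide_distrib)
  qed
  finally show "kingman_phi t \<alpha> \<mu> = (\<Sum>\<nu> | is_partition \<nu> \<and> \<nu> \<searrow> \<mu>. ?f \<nu>)" ..
qed


section \<open>Evaluation of series and polynomials\<close>

definition mon_eval :: "(nat \<Rightarrow> complex) \<Rightarrow> monom \<Rightarrow> complex" where
  "mon_eval v m = (\<Prod>i\<in>Poly_Mapping.keys m. v i ^ Poly_Mapping.lookup m i)"

text \<open>\<open>Sum_any\<close> is 0 if infinitely many terms are nonzero, so multiplicativity
  below carries finiteness assumptions. They hold for polynomials, and for series of bounded degree
  at points with finitely many nonzero coordinates.\<close>

definition series_eval :: "(nat \<Rightarrow> complex) \<Rightarrow> (monom \<Rightarrow> complex) \<Rightarrow> complex" where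
  "series_eval v f = Sum_any (\<lambda>m. f m * mon_eval v m)"

lemma mon_eval_superset:
  assumes "finite A" "Poly_Mapping.keys m \<subseteq> A"
  shows "mon_eval v m = (\<Prod>i\<in>A. v i ^ Poly_Mapping.lookup m i)"
  unfolding mon_eval_def using assms
  by (intro prod.mono_neutral_left) (auto simp: in_keys_iff)

lemma mon_eval_add: "mon_eval v (a + b) = mon_eval v a * mon_eval v b"
proof -
  let ?A = "Poly_Mapping.keys a \<union> Poly_Mapping.keys b"
  have "mon_eval v (a + b) = (\<Prod>i\<in>?A. v i ^ Poly_Mapping.lookup (a + b) i)"
    using keys_add[of a b] by (intro mon_eval_superset) auto
  then show ?thesis
    by (simp add: mon_eval_superset[where A = ?A] lookup_add power_add prod.distrib)
qed

lemma mon_eval_zero [simp]: "mon_eval v 0 = 1"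
  by (simp add: mon_eval_def)

lemma mon_eval_single [simp]: "mon_eval v (Poly_Mapping.single i e) = v i ^ e"
  by (cases "e = 0") (simp_all add: mon_eval_def)

text \<open>The product of the two values is a sum over the finite rectangle of pairs with nonzero
  terms. Grouping these pairs by their sum gives the Cauchy product, since all other pairs
  contribute 0.\<close>

lemma series_eval_cauchy_prod:
  assumes F: "finite {m. f m * mon_eval v m \<noteq> 0}" and G: "finite {m. g m * mon_eval v m \<noteq> 0}"
  shows "series_eval v (cauchy_prod f g) = series_eval v f * series_eval v g"
proof -
  let ?F = "{m. f m * mon_eval v m \<noteq> 0}" and ?G = "{m. g m * mon_eval v m \<noteq> 0}"
  let ?X = "\<lambda>p. (f (fst p) * mon_eval v (fst p)) * (g (snd p) * mon_eval v (snd p))"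
  let ?s = "\<lambda>p. fst p + snd p :: monom"
  let ?M = "?s ` (?F \<times> ?G)"
  have X: "cauchy_prod f g m * mon_eval v m = (\<Sum>p\<in>{p. ?s p = m}. ?X p)" for m
    unfolding cauchy_prod_def sum_distrib_right
    by (rule sum.cong) (auto simp: mon_eval_add mult_ac)
  have inner: "(\<Sum>p\<in>{p. ?s p = m}. ?X p) = (\<Sum>p\<in>{p \<in> ?F \<times> ?G. ?s p = m}. ?X p)" for m
  proof (rule sum.mono_neutral_right)
    show "finite {p. ?s p = m}"
      using finite_splits[of m] by (simp add: case_prod_beta')
  qed auto
  have "series_eval v f * series_eval v g = (\<Sum>p\<in>?F \<times> ?G. ?X p)"
    unfolding series_eval_def Sum_any.expand_set sum_product sum.cartesian_product
    by (simp add: case_prod_beta')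
  also have "\<dots> = (\<Sum>m\<in>?M. \<Sum>p\<in>{p \<in> ?F \<times> ?G. ?s p = m}. ?X p)"
    by (rule sum.image_gen) (use F G in auto)
  also have "\<dots> = (\<Sum>m\<in>?M. cauchy_prod f g m * mon_eval v m)"
    unfolding X inner ..
  also have "\<dots> = series_eval v (cauchy_prod f g)"
    unfolding series_eval_def
  proof (rule Sum_any.expand_superset[symmetric])
    show "finite ?M"
      using F G by auto
    show "{m. cauchy_prod f g m * mon_eval v m \<noteq> 0} \<subseteq> ?M"
    proof
      fix m
      assume "m \<in> {m. cauchy_prod f g m * mon_eval v m \<noteq> 0}"
      then have "(\<Sum>p\<in>{p \<in> ?F \<times> ?G. ?s p = m}. ?X p) \<noteq> 0"
        by (simp only: X inner mem_Collect_eq not_False_eq_True)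
      then show "m \<in> ?M"
        by (elim sum.not_neutral_contains_not_neutral) blast
    qed
  qed
  finally show ?thesis ..
qed

definition poly_eval :: "(nat \<Rightarrow> complex) \<Rightarrow> (monom \<Rightarrow>\<^sub>0 complex) \<Rightarrow> complex" where
  "poly_eval v F = series_eval v (Poly_Mapping.lookup F)"

lemma poly_eval_superset:
  assumes "finite A" "Poly_Mapping.keys F \<subseteq> A"
  shows "poly_eval v F = (\<Sum>m\<in>A. Poly_Mapping.lookup F m * mon_eval v m)"
  unfolding poly_eval_def series_eval_def using assms
  by (intro Sum_any.expand_superset) (auto simp: in_keys_iff)

lemma poly_eval_mult: "poly_eval v (F * G) = poly_eval v F * poly_eval v G"
proof -
  have fin: "finite {m. Poly_Mapping.lookup F m * mon_eval v m \<noteq> 0}" for F :: "monom \<Rightarrow>\<^sub>0 complex"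
    by (rule finite_subset[OF _ finite_keys[of F]]) (auto simp: in_keys_iff)
  have "Poly_Mapping.lookup (F * G) = cauchy_prod (Poly_Mapping.lookup F) (Poly_Mapping.lookup G)"
    by (rule ext) (simp add: lookup_times_splits cauchy_prod_def)
  then show ?thesis
    by (simp add: poly_eval_def series_eval_cauchy_prod[OF fin fin])
qed

lemma poly_eval_one [simp]: "poly_eval v 1 = 1"
  by (subst poly_eval_superset[of "{0}"]) (auto simp: lookup_one when_def)

lemma poly_eval_prod: "poly_eval v (\<Prod>k\<in>A. F k) = (\<Prod>k\<in>A. poly_eval v (F k))"
  by (induction A rule: infinite_finite_induct) (simp_all add: poly_eval_mult)

lemma poly_eval_pvar_minus: "poly_eval v (pvar i - of_nat k) = v i - of_nat k"
proof -
  have "Poly_Mapping.single i (Suc 0) \<noteq> (0 :: monom)"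
    by (simp flip: keys_eq_empty)
  then show ?thesis
    by (subst poly_eval_superset[of "{0, Poly_Mapping.single i 1}"])
      (auto simp: in_keys_iff pvar_def lookup_minus lookup_single when_def lookup_of_nat_monom split: if_splits)
qed


section \<open>Products of falling factorials\<close>

text \<open>Indexing the expressions by exponent vectors instead of permutations removes the
  repetitions caused by equal parts.\<close>

definition falling_monom :: "monom \<Rightarrow> monom \<Rightarrow>\<^sub>0 complex" where
  "falling_monom m = (\<Prod>i\<in>Poly_Mapping.keys m. \<Prod>k<Poly_Mapping.lookup m i. (pvar i - of_nat k))"

lemma poly_eval_falling_monom:
  "poly_eval v (falling_monom m) = (\<Prod>i\<in>Poly_Mapping.keys m. \<Prod>k<Poly_Mapping.lookup m i. (v i - of_nat k))"
  by (simp add: falling_monom_def poly_eval_prod poly_eval_pvar_minus)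

text \<open>At a point with natural coordinates \<open>n\<close>, the product vanishes unless \<open>m \<le> n\<close>.\<close>

lemma inj_falling_monom: "inj falling_monom"
proof (rule injI)
  have le: "Poly_Mapping.lookup m i \<le> Poly_Mapping.lookup n i" if eq: "falling_monom m = falling_monom n" for m n i
  proof (rule ccontr)
    let ?v = "\<lambda>i. of_nat (Poly_Mapping.lookup n i) :: complex"
    assume "\<not> ?thesis"
    then have less: "Poly_Mapping.lookup n i < Poly_Mapping.lookup m i"
      by simp
    then have "(\<Prod>k<Poly_Mapping.lookup m i. (?v i - of_nat k)) = 0"
      by (intro prod_zero) auto
    then have "poly_eval ?v (falling_monom m) = 0"
      unfolding poly_eval_falling_monom using less
      by (intro prod_zero[OF finite_keys bexI[of _ i]]) (simp_all only: in_keys_iff)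
    moreover have "poly_eval ?v (falling_monom n) \<noteq> 0"
      unfolding poly_eval_falling_monom by auto
    ultimately show False
      using eq by simp
  qed
  show "m = n" if "falling_monom m = falling_monom n" for m n
    using le[OF that] le[OF that[symmetric]] by (auto intro!: poly_mapping_eqI simp: order_antisym)
qed

text \<open>The factor with k = 0 is the variable itself, so the product is divisible by every
  variable in the support of \<open>m\<close>.\<close>

lemma keys_falling_monom:
  assumes "Poly_Mapping.lookup (falling_monom m) n \<noteq> 0"
  shows "Poly_Mapping.keys m \<subseteq> Poly_Mapping.keys n"
proof
  fix i
  assume i: "i \<in> Poly_Mapping.keys m"
  then have "0 < Poly_Mapping.lookup m i"
    by (simp add: in_keys_iff)
  then have "pvar i - of_nat 0 dvd (\<Prod>k<Poly_Mapping.lookup m i. (pvar i - of_nat k))"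
    by (intro dvd_prodI) auto
  also have "\<dots> dvd falling_monom m"
    unfolding falling_monom_def using i by (intro dvd_prodI) auto
  finally obtain G where "falling_monom m = pvar i * G"
    by (auto elim: dvdE)
  then obtain a b where "a + b = n" "Poly_Mapping.lookup (pvar i) a \<noteq> 0"
    using assms by (auto simp: lookup_times_splits elim!: sum.not_neutral_contains_not_neutral)
  then show "i \<in> Poly_Mapping.keys n"
    by (auto simp: pvar_def lookup_single when_def in_keys_iff lookup_add split: if_splits)
qed

text \<open>\<open>Poly_Mapping.nth \<mu>\<close> is the exponent vector formed by the parts and
  padded with zeros. The orbit consists of the exponents occurring in the ordinary monomial
  symmetric function of \<mu>.\<close>

definition monom_orbit :: "nat list \<Rightarrow> monom set" where
  "monom_orbit \<mu> = {Poly_Mapping.map_key q (Poly_Mapping.nth \<mu>) | q. bij q}"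

lemma keys_map_key:
  assumes "bij p"
  shows "Poly_Mapping.keys (Poly_Mapping.map_key p m) = p -` Poly_Mapping.keys m"
  using assms by (auto simp: in_keys_iff lookup_map_key bij_is_inj)

lemma keys_nth_partition: "is_partition \<mu> \<Longrightarrow> Poly_Mapping.keys (Poly_Mapping.nth \<mu>) = {..<length \<mu>}"
  using is_partition_nth_pos[of \<mu>] by (fastforce simp: in_keys_iff lookup_nth nth_default_def simp del: keys_nth split: if_splits)

lemma prod_map_key:
  assumes "bij p"
  shows "(\<Prod>i\<in>Poly_Mapping.keys (Poly_Mapping.map_key p m). h i (Poly_Mapping.lookup (Poly_Mapping.map_key p m) i)) =
    (\<Prod>j\<in>Poly_Mapping.keys m. h (inv p j) (Poly_Mapping.lookup m j))"
  by (rule prod.reindex_bij_witness[where i = "inv p" and j = p])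
    (use assms in \<open>auto simp: keys_map_key lookup_map_key bij_is_inj bij_is_surj surj_f_inv_f\<close>)

text \<open>The inverse occurs because \<open>map_key\<close> precomposes the exponent function,
  whereas \<open>p\<close> sends position i to the variable with index p i.\<close>

lemma factorial_expr_eq:
  assumes "is_partition \<mu>" "bij p"
  shows "factorial_expr \<mu> p = falling_monom (Poly_Mapping.map_key (inv p) (Poly_Mapping.nth \<mu>))"
  unfolding falling_monom_def factorial_expr_def
  by (subst prod_map_key)
    (use assms in \<open>auto simp: bij_imp_bij_inv inv_inv_eq keys_nth_partition nth_default_nth
      simp del: keys_nth intro!: prod.cong\<close>)

lemma factorial_exprs_eq:
  assumes "is_partition \<mu>"
  shows "factorial_exprs \<mu> = falling_monom ` monom_orbit \<mu>"
proof -
  have "factorial_exprs \<mu> = falling_monom ` {Poly_Mapping.map_key (inv p) (Poly_Mapping.nth \<mu>) | p. bij p}"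
    unfolding factorial_exprs_def setcompr_eq_image image_image
    by (intro image_cong refl factorial_expr_eq[OF assms]) simp
  also have "{Poly_Mapping.map_key (inv p) (Poly_Mapping.nth \<mu>) | p. bij p} = monom_orbit \<mu>"
  proof (intro equalityI subsetI)
    fix m
    assume "m \<in> monom_orbit \<mu>"
    then obtain q where "bij q" "m = Poly_Mapping.map_key (inv (inv q)) (Poly_Mapping.nth \<mu>)"
      by (auto simp: monom_orbit_def inv_inv_eq)
    then show "m \<in> {Poly_Mapping.map_key (inv p) (Poly_Mapping.nth \<mu>) | p. bij p}"
      using bij_imp_bij_inv by blast
  qed (auto simp: monom_orbit_def intro: bij_imp_bij_inv)
  finally show ?thesis .
qed


section \<open>Sums over orbits of the symmetric group\<close>

text \<open>The complements of \<open>A\<close> and of its image are infinite sets of natural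
  numbers, hence in bijection. This makes the symmetry under permutations of all variables
  applicable to a matching of two finite sets.\<close>

lemma bij_extend:
  fixes h :: "nat \<Rightarrow> nat"
  assumes "finite A" "inj_on h A"
  obtains p where "bij p" "\<And>x. x \<in> A \<Longrightarrow> p x = h x"
proof -
  have "infinite (- A)" "infinite (- (h ` A))"
    using assms by (simp_all add: Compl_eq_Diff_UNIV)
  then obtain g where "bij_betw g (- A) (- (h ` A))"
    by (meson bij_betw_inv_into bij_betw_trans bij_enumerate)
  moreover have "bij_betw h A (h ` A)"
    using assms by (simp add: bij_betw_def)
  ultimately have "bij_betw (\<lambda>x. if x \<in> A then h x else g x)
      (A \<union> - A) (h ` A \<union> - (h ` A))"
    by (intro bij_betw_disjoint_Un) auto
  then show thesis
    by (intro that[of "\<lambda>x. if x \<in> A then h x else g x"]) auto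
qed

lemma mdeg_map_key:
  assumes "bij p"
  shows "mdeg (Poly_Mapping.map_key p m) = mdeg m"
  unfolding mdeg_def
  by (rule sum.reindex_bij_witness[where i = "inv p" and j = p])
    (use assms in \<open>auto simp: keys_map_key lookup_map_key bij_is_inj bij_is_surj surj_f_inv_f\<close>)

lemma card_keys_le_mdeg: "card (Poly_Mapping.keys m) \<le> mdeg m"
proof -
  have "(\<Sum>i\<in>Poly_Mapping.keys m. 1) \<le> mdeg m"
    unfolding mdeg_def by (rule sum_mono) (simp add: in_keys_iff)
  then show ?thesis by simp
qed

lemma finite_monoms:
  assumes "finite A"
  shows "finite {m. Poly_Mapping.keys m \<subseteq> A \<and> mdeg m \<le> d}"
proof -
  let ?F = "{f :: nat \<Rightarrow> nat. \<forall>i. (i \<in> A \<longrightarrow> f i \<in> {..d}) \<and> (i \<notin> A \<longrightarrow> f i = 0)}"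
  have F: "finite ?F"
    by (intro finite_set_of_finite_funs) (use assms in auto)
  have le: "Poly_Mapping.lookup m i \<le> mdeg m" for m :: monom and i
  proof (cases "i \<in> Poly_Mapping.keys m")
    case True
    then show ?thesis
      unfolding mdeg_def by (intro member_le_sum) auto
  qed (simp add: in_keys_iff)
  have "Poly_Mapping.lookup ` {m. Poly_Mapping.keys m \<subseteq> A \<and> mdeg m \<le> d} \<subseteq> ?F"
    by (auto simp: in_keys_iff subset_iff intro: order_trans[OF le])
  then show ?thesis
    using F by (meson finite_imageD finite_subset inj_onI poly_mapping.lookup_inject)
qed

text \<open>The share of monomials with support exactly S in the value of f when these variables
  equal a. The bound d keeps the sum finite for finite S and loses nothing if it bounds the degree
  of f.\<close>

definition support_sum :: "(monom \<Rightarrow> complex) \<Rightarrow> complex \<Rightarrow> nat \<Rightarrow> nat set \<Rightarrow> complex" where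
  "support_sum f a d S = (\<Sum>m | Poly_Mapping.keys m = S \<and> mdeg m \<le> d. f m * a ^ mdeg m)"

text \<open>A permutation carrying the initial segment to S matches the monomials of both supports
  and preserves degrees and, by symmetry, coefficients.\<close>

lemma support_sum_card:
  assumes f: "symmetric_series f" and "finite S"
  shows "support_sum f a d S = support_sum f a d {..<card S}"
proof -
  obtain h where h: "bij_betw h {..<card S} S"
    using ex_bij_betw_nat_finite[OF \<open>finite S\<close>] by (auto simp: lessThan_atLeast0)
  then obtain p where p: "bij p" "\<And>i. i \<in> {..<card S} \<Longrightarrow> p i = h i"
    using bij_extend[of "{..<card S}" h] by (auto simp: bij_betw_def)
  then have image: "p ` {..<card S} = S"
    using h by (auto simp: bij_betw_def image_def)
  then have vimage: "p -` S = {..<card S}"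
    using bij_is_inj[OF p(1)] by (metis inj_vimage_image_eq)
  have "inv p -` {..<card S} = S"
    using image bij_vimage_eq_inv_image[OF bij_imp_bij_inv[OF p(1)]] by (simp add: inv_inv_eq p)
  with vimage show ?thesis
    unfolding support_sum_def
    by (intro sum.reindex_bij_witness[where i = "Poly_Mapping.map_key (inv p)" and j = "Poly_Mapping.map_key p"])
      (use f p in \<open>auto simp: map_key_inv mdeg_map_key keys_map_key bij_imp_bij_inv symmetric_series_def\<close>)
qed

text \<open>All \<open>N choose l\<close> supports of size l contribute equally. The dependence on N
  is thus confined to binomial coefficients and the range of l, which allows N to be replaced by a
  complex parameter.\<close>

lemma sum_symmetric_monoms:
  assumes f: "symmetric_series f"
  shows "(\<Sum>m | Poly_Mapping.keys m \<subseteq> {..<N} \<and> mdeg m \<le> d. f m * a ^ mdeg m) =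
    (\<Sum>l\<le>N. of_nat (N choose l) * support_sum f a d {..<l})"
proof -
  have "(\<Sum>m | Poly_Mapping.keys m \<subseteq> {..<N} \<and> mdeg m \<le> d. f m * a ^ mdeg m) =
      (\<Sum>S\<in>Pow {..<N}. \<Sum>m | m \<in> {m. Poly_Mapping.keys m \<subseteq> {..<N} \<and> mdeg m \<le> d} \<and> Poly_Mapping.keys m = S. f m * a ^ mdeg m)"
    by (rule sum.group[symmetric]) (auto simp: finite_monoms)
  also have "\<dots> = (\<Sum>S\<in>Pow {..<N}. support_sum f a d S)"
    unfolding support_sum_def by (intro sum.cong refl) auto
  also have "\<dots> = (\<Sum>S\<in>Pow {..<N}. support_sum f a d {..<card S})"
    by (intro sum.cong refl support_sum_card[OF f]) (auto intro: finite_subset)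
  also have "\<dots> = (\<Sum>l\<le>N. \<Sum>S | S \<in> Pow {..<N} \<and> card S = l. support_sum f a d {..<card S})"
    by (rule sum.group[symmetric]) (auto dest: card_mono[rotated])
  also have "\<dots> = (\<Sum>l\<le>N. of_nat (N choose l) * support_sum f a d {..<l})"
    using n_subsets[of "{..<N}"] by (intro sum.cong refl) simp
  finally show ?thesis .
qed

lemma support_sum_large: "l > d \<Longrightarrow> support_sum f a d {..<l} = 0"
proof -
  assume l: "l > d"
  have "\<not> mdeg m \<le> d" if "Poly_Mapping.keys m = {..<l}" for m
    using card_keys_le_mdeg[of m] l that by simp
  then have "{m. Poly_Mapping.keys m = {..<l} \<and> mdeg m \<le> d} = {}"
    by blast
  then show ?thesis
    unfolding support_sum_def by (simp only: sum.empty)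
qed

section \<open>Points with N coordinates equal to a and all others zero\<close>

abbreviation const_point :: "nat \<Rightarrow> complex \<Rightarrow> nat \<Rightarrow> complex" where
  "const_point N a \<equiv> (\<lambda>i. if i < N then a else 0)"

lemma mon_eval_const_point:
  "mon_eval (const_point N a) m = (if Poly_Mapping.keys m \<subseteq> {..<N} then a ^ mdeg m else 0)"
proof (cases "Poly_Mapping.keys m \<subseteq> {..<N}")
  case True
  then show ?thesis
    by (auto simp: mon_eval_def mdeg_def power_sum intro!: prod.cong)
next
  case False
  then obtain i where "i \<in> Poly_Mapping.keys m" "\<not> i < N"
    by auto
  then have "mon_eval (const_point N a) m = 0"
    unfolding mon_eval_def by (intro prod_zero) (auto simp: in_keys_iff intro!: bexI[of _ i])
  with False show ?thesis by simp
qed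

lemma series_eval_const_point:
  assumes "\<forall>m. f m \<noteq> 0 \<longrightarrow> mdeg m \<le> d"
  shows "series_eval (const_point N a) f =
      (\<Sum>m | Poly_Mapping.keys m \<subseteq> {..<N} \<and> mdeg m \<le> d. f m * a ^ mdeg m)"
    "finite {m. f m * mon_eval (const_point N a) m \<noteq> 0}"
proof -
  let ?M = "{m. Poly_Mapping.keys m \<subseteq> {..<N} \<and> mdeg m \<le> d}"
  have fin: "finite ?M"
    by (simp add: finite_monoms)
  have sub: "{m. f m * mon_eval (const_point N a) m \<noteq> 0} \<subseteq> ?M"
    using assms by (auto simp: mon_eval_const_point split: if_splits)
  show "finite {m. f m * mon_eval (const_point N a) m \<noteq> 0}"
    by (rule finite_subset[OF sub fin])
  show "series_eval (const_point N a) f = (\<Sum>m\<in>?M. f m * a ^ mdeg m)"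
    unfolding series_eval_def Sum_any.expand_superset[OF fin sub]
    by (intro sum.cong refl) (simp add: mon_eval_const_point)
qed

section \<open>Counting the exponent vectors in an orbit\<close>

lemma map_key_orbit: "bij p \<Longrightarrow> m \<in> monom_orbit \<mu> \<Longrightarrow> Poly_Mapping.map_key p m \<in> monom_orbit \<mu>"
proof -
  assume p: "bij p" and "m \<in> monom_orbit \<mu>"
  then obtain q where q: "bij q" "m = Poly_Mapping.map_key q (Poly_Mapping.nth \<mu>)"
    by (auto simp: monom_orbit_def)
  then have "Poly_Mapping.map_key p m = Poly_Mapping.map_key (q \<circ> p) (Poly_Mapping.nth \<mu>)"
    using p bij_comp[OF p q(1)] by (auto intro!: poly_mapping_eqI simp: lookup_map_key bij_is_inj)
  with bij_comp[OF p q(1)] show ?thesis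
    unfolding monom_orbit_def by blast
qed

text \<open>The parts are nonzero exactly at the first \<open>length \<mu>\<close> positions. A
  permutation producing this support maps the segment onto itself and only rearranges the parts;
  conversely, a rearrangement extends by the identity.\<close>

lemma orbit_permutations:
  assumes \<mu>: "is_partition \<mu>"
  shows "bij_betw Poly_Mapping.nth (permutations_of_multiset (mset \<mu>))
    {m \<in> monom_orbit \<mu>. Poly_Mapping.keys m = {..<length \<mu>}}"
proof (rule bij_betw_imageI)
  have pos: "is_partition \<mu> \<Longrightarrow> x \<in> set xs \<Longrightarrow> mset xs = mset \<mu> \<Longrightarrow> x \<noteq> 0" for x xs
    by (metis is_partition_def set_mset_mset)
  have lookup: "Poly_Mapping.lookup (Poly_Mapping.nth xs) i = (if i < length xs then xs ! i else 0)"
    for xs :: "nat list" and i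
    by (simp add: lookup_nth nth_default_def)
  show "inj_on Poly_Mapping.nth (permutations_of_multiset (mset \<mu>))"
  proof (rule inj_onI)
    fix xs ys
    assume xy: "xs \<in> permutations_of_multiset (mset \<mu>)" "ys \<in> permutations_of_multiset (mset \<mu>)"
      and eq: "Poly_Mapping.nth xs = Poly_Mapping.nth ys"
    then have len: "length xs = length ys"
      by (metis permutations_of_multisetD size_mset)
    have "xs ! i = ys ! i" if "i < length xs" for i
      using lookup[of xs i] lookup[of ys i] that len eq by (simp del: lookup_nth)
    then show "xs = ys"
      using nth_equalityI[OF len] by blast
  qed
  show "Poly_Mapping.nth ` permutations_of_multiset (mset \<mu>) =
      {m \<in> monom_orbit \<mu>. Poly_Mapping.keys m = {..<length \<mu>}}" (is "?L = ?R")
  proof (intro equalityI subsetI)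
    fix m
    assume "m \<in> ?L"
    then obtain xs where xs: "mset xs = mset \<mu>" "m = Poly_Mapping.nth xs"
      by (auto dest: permutations_of_multisetD)
    then obtain p where p: "p permutes {..<length \<mu>}" "permute_list p \<mu> = xs"
      using mset_eq_permutation by metis
    have len: "length xs = length \<mu>"
      using xs(1) by (metis size_mset)
    have "m = Poly_Mapping.map_key p (Poly_Mapping.nth \<mu>)"
    proof (rule poly_mapping_eqI)
      fix i
      have "p i < length \<mu> \<longleftrightarrow> i < length \<mu>"
        using permutes_in_image[OF p(1), of i] by simp
      then show "Poly_Mapping.lookup m i = Poly_Mapping.lookup (Poly_Mapping.map_key p (Poly_Mapping.nth \<mu>)) i"
        using p len permute_list_nth[OF p(1)]
        by (auto simp: xs(2) lookup lookup_map_key permutes_inj simp del: lookup_nth)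
    qed
    moreover have "Poly_Mapping.keys m = {..<length \<mu>}"
      using pos[OF \<mu> _ xs(1)] nth_mem[of _ xs] len
      by (auto simp: xs(2) in_keys_iff lookup simp del: lookup_nth keys_nth split: if_splits)
    ultimately show "m \<in> ?R"
      using permutes_bij[OF p(1)] by (auto simp: monom_orbit_def)
  next
    fix m
    assume "m \<in> ?R"
    then obtain q where q: "bij q" and m: "m = Poly_Mapping.map_key q (Poly_Mapping.nth \<mu>)"
      and k: "Poly_Mapping.keys m = {..<length \<mu>}"
      by (auto simp: monom_orbit_def)
    have vimage: "q -` {..<length \<mu>} = {..<length \<mu>}"
      using k by (simp add: m keys_map_key[OF q] keys_nth_partition[OF \<mu>] del: keys_nth)
    then have image: "q ` {..<length \<mu>} = {..<length \<mu>}"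
      using bij_is_surj[OF q] by (metis surj_image_vimage_eq)
    define xs where "xs = map (\<lambda>i. \<mu> ! q i) [0..<length \<mu>]"
    have "mset xs = image_mset (\<lambda>i. \<mu> ! i) (image_mset q (mset_set {..<length \<mu>}))"
      by (simp add: xs_def lessThan_atLeast0 multiset.map_comp comp_def)
    also have "image_mset q (mset_set {..<length \<mu>}) = mset_set {..<length \<mu>}"
      using image_mset_mset_set[of q "{..<length \<mu>}"] image bij_is_inj[OF q] by (simp add: inj_on_subset)
    also have "image_mset (\<lambda>i. \<mu> ! i) (mset_set {..<length \<mu>}) = mset \<mu>"
      by (metis map_nth mset_map mset_upt lessThan_atLeast0)
    finally have "xs \<in> permutations_of_multiset (mset \<mu>)"
      by (rule permutations_of_multisetI)
    moreover have "m = Poly_Mapping.nth xs"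
    proof (rule poly_mapping_eqI)
      fix i
      have "q i < length \<mu> \<longleftrightarrow> i < length \<mu>"
        using vimage by (metis lessThan_iff vimage_eq)
      then show "Poly_Mapping.lookup m i = Poly_Mapping.lookup (Poly_Mapping.nth xs) i"
        by (simp add: m lookup_map_key bij_is_inj[OF q] lookup xs_def del: lookup_nth)
    qed
    ultimately show "m \<in> ?L"
      by blast
  qed
qed

text \<open>The indicator function of the orbit is symmetric, so \<open>sum_symmetric_monoms\<close>
  with all variables 1 counts its elements. Only supports of size \<open>length \<mu>\<close> occur,
  and each carries as many elements as the multiset of parts has arrangements.\<close>

lemma card_orbit:
  assumes \<mu>: "is_partition \<mu>"
  shows "of_nat (card {m \<in> monom_orbit \<mu>. Poly_Mapping.keys m \<subseteq> {..<N}}) =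
    of_nat (N choose length \<mu>) * fact (length \<mu>) / mult_fact \<mu>"
proof -
  define d where "d = mdeg (Poly_Mapping.nth \<mu>)"
  define f :: "monom \<Rightarrow> complex" where "f m = (if m \<in> monom_orbit \<mu> then 1 else 0)" for m
  have deg: "mdeg m = d" if "m \<in> monom_orbit \<mu>" for m
    using that by (auto simp: monom_orbit_def d_def mdeg_map_key)
  have "symmetric_series f"
    unfolding symmetric_series_def f_def
  proof (intro allI impI)
    fix p :: "nat \<Rightarrow> nat" and m :: monom
    assume p: "bij p"
    have "Poly_Mapping.map_key p m \<in> monom_orbit \<mu> \<longleftrightarrow> m \<in> monom_orbit \<mu>"
      using map_key_orbit[OF p, of m \<mu>] map_key_orbit[OF bij_imp_bij_inv[OF p], of "Poly_Mapping.map_key p m" \<mu>]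
      by (auto simp: map_key_inv[OF p])
    then show "(if Poly_Mapping.map_key p m \<in> monom_orbit \<mu> then 1 else 0) = (if m \<in> monom_orbit \<mu> then 1 else 0 :: complex)"
      by simp
  qed
  note s = sum_symmetric_monoms[OF this, of 1 N d]
  have "support_sum f 1 d {..<l} = of_nat (card {m \<in> monom_orbit \<mu>. Poly_Mapping.keys m = {..<l}})" for l
  proof -
    have "support_sum f 1 d {..<l} = (\<Sum>m\<in>{m \<in> monom_orbit \<mu>. Poly_Mapping.keys m = {..<l}}. 1)"
      unfolding support_sum_def
    proof (rule sum.mono_neutral_cong_right)
      show "finite {m. Poly_Mapping.keys m = {..<l} \<and> mdeg m \<le> d}"
        by (rule finite_subset[OF _ finite_monoms[of "{..<l}" d]]) auto
      show "{m \<in> monom_orbit \<mu>. Poly_Mapping.keys m = {..<l}} \<subseteq> {m. Poly_Mapping.keys m = {..<l} \<and> mdeg m \<le> d}"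
        using deg by (intro subsetI CollectI) (metis (mono_tags) mem_Collect_eq order_refl)
    qed (simp_all add: f_def, blast)
    then show ?thesis by simp
  qed
  moreover have "card {m \<in> monom_orbit \<mu>. Poly_Mapping.keys m = {..<l}} = 0" if "l \<noteq> length \<mu>" for l
  proof -
    have card: "card (Poly_Mapping.keys m) = length \<mu>" if "m \<in> monom_orbit \<mu>" for m
    proof -
      from that obtain q where "bij q" "Poly_Mapping.keys m = q -` {..<length \<mu>}"
        using keys_nth_partition[OF \<mu>] by (auto simp: monom_orbit_def keys_map_key simp del: keys_nth)
      then show ?thesis
        by (simp add: card_vimage_inj bij_is_inj bij_is_surj)
    qed
    have "Poly_Mapping.keys m \<noteq> {..<l}" if "m \<in> monom_orbit \<mu>" for m
      using card[OF that] \<open>l \<noteq> length \<mu>\<close> by (metis card_lessThan)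
    then have "{m \<in> monom_orbit \<mu>. Poly_Mapping.keys m = {..<l}} = {}"
      by blast
    then show ?thesis
      by (simp only: card.empty)
  qed
  ultimately have T: "support_sum f 1 d {..<l} =
      (if l = length \<mu> then of_nat (card (permutations_of_multiset (mset \<mu>))) else 0)" for l
    unfolding bij_betw_same_card[OF orbit_permutations[OF \<mu>]] by (cases "l = length \<mu>") simp_all
  have "of_nat (card (permutations_of_multiset (mset \<mu>))) * mult_fact \<mu> = fact (length \<mu>)"
    using arg_cong[OF card_permutations_of_multiset_aux[of "mset \<mu>"], of "of_nat :: nat \<Rightarrow> complex"]
    unfolding mult_fact_mset by (simp del: count_mset)
  then have P: "of_nat (card (permutations_of_multiset (mset \<mu>))) = fact (length \<mu>) / mult_fact \<mu>"
    by (simp add: nonzero_eq_divide_eq)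
  have "of_nat (card {m \<in> monom_orbit \<mu>. Poly_Mapping.keys m \<subseteq> {..<N}}) =
      (\<Sum>m\<in>{m \<in> monom_orbit \<mu>. Poly_Mapping.keys m \<subseteq> {..<N}}. 1 :: complex)"
    by simp
  also have "\<dots> = (\<Sum>m | Poly_Mapping.keys m \<subseteq> {..<N} \<and> mdeg m \<le> d. f m * 1 ^ mdeg m)"
    by (rule sum.mono_neutral_cong_left) (simp_all add: finite_monoms, auto simp: f_def deg)
  also have "\<dots> = (\<Sum>l\<le>N. if l = length \<mu> then of_nat (N choose l) * (fact (length \<mu>) / mult_fact \<mu>) else 0)"
    unfolding s T P by (intro sum.cong refl) simp
  \<comment> \<open>If \<open>length \<mu>\<close> exceeds N, no term of the sum is selected, and
    the binomial coefficient is 0 too.\<close>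
  also have "\<dots> = of_nat (N choose length \<mu>) * fact (length \<mu>) / mult_fact \<mu>"
    by (simp add: sum.delta binomial_eq_0)
  finally show ?thesis .
qed

lemma finite_orbit:
  "finite {m \<in> monom_orbit \<mu>. Poly_Mapping.keys m \<subseteq> {..<N}}"
proof (rule finite_subset)
  show "{m \<in> monom_orbit \<mu>. Poly_Mapping.keys m \<subseteq> {..<N}} \<subseteq>
      {m. Poly_Mapping.keys m \<subseteq> {..<N} \<and> mdeg m \<le> mdeg (Poly_Mapping.nth \<mu>)}"
    by (auto simp: monom_orbit_def mdeg_map_key)
qed (simp add: finite_monoms)

text \<open>Only the expressions in the first N variables matter at this point, and they all take
  the same value; \<open>card_orbit\<close> counts them.\<close>

lemma series_eval_factorial_monom:
  assumes \<mu>: "is_partition \<mu>"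
  shows "series_eval (const_point N a) (factorial_monom_coeff \<mu>) =
    of_nat (N choose length \<mu>) * fact (length \<mu>) / mult_fact \<mu> * (\<Prod>i<length \<mu>. \<Prod>k<\<mu> ! i. (a - of_nat k))"
proof -
  let ?O = "{m \<in> monom_orbit \<mu>. Poly_Mapping.keys m \<subseteq> {..<N}}"
  define d where "d = (\<Sum>i<length \<mu>. \<Sum>k<\<mu> ! i. 1 :: nat)"
  let ?M = "{m. Poly_Mapping.keys m \<subseteq> {..<N} \<and> mdeg m \<le> d}"
  have expr_deg: "mdeg n \<le> d" if "m \<in> monom_orbit \<mu>" "Poly_Mapping.lookup (falling_monom m) n \<noteq> 0" for m n
  proof -
    have "falling_monom m \<in> factorial_exprs \<mu>"
      using that factorial_exprs_eq[OF \<mu>] by blast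
    then show ?thesis
      using that(2) lookup_factorial_expr_mdeg unfolding factorial_exprs_def d_def by auto
  qed
  have coeff: "factorial_monom_coeff \<mu> n = (\<Sum>m\<in>?O. Poly_Mapping.lookup (falling_monom m) n)"
    if "Poly_Mapping.keys n \<subseteq> {..<N}" for n
  proof -
    let ?O' = "{m \<in> monom_orbit \<mu>. Poly_Mapping.lookup (falling_monom m) n \<noteq> 0}"
    have "{F \<in> factorial_exprs \<mu>. Poly_Mapping.lookup F n \<noteq> 0} = falling_monom ` ?O'"
      unfolding factorial_exprs_eq[OF \<mu>] by auto
    then have "factorial_monom_coeff \<mu> n = (\<Sum>m\<in>?O'. Poly_Mapping.lookup (falling_monom m) n)"
      unfolding factorial_monom_coeff_def
      by (simp add: sum.reindex inj_on_subset[OF inj_falling_monom])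
    \<comment> \<open>A monomial in the first N variables occurs only in products over these
      variables, by \<open>keys_falling_monom\<close>.\<close>
    also have "\<dots> = (\<Sum>m\<in>?O. Poly_Mapping.lookup (falling_monom m) n)"
      by (rule sum.mono_neutral_left) (use that keys_falling_monom finite_orbit in blast)+
    finally show ?thesis .
  qed
  have coeff_deg: "\<forall>n. factorial_monom_coeff \<mu> n \<noteq> 0 \<longrightarrow> mdeg n \<le> d"
  proof (intro allI impI)
    fix n
    assume "factorial_monom_coeff \<mu> n \<noteq> 0"
    then obtain F where "F \<in> factorial_exprs \<mu>" "Poly_Mapping.lookup F n \<noteq> 0"
      unfolding factorial_monom_coeff_def by (auto elim!: sum.not_neutral_contains_not_neutral)
    then show "mdeg n \<le> d"
      using expr_deg unfolding factorial_exprs_eq[OF \<mu>] by blast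
  qed
  have "series_eval (const_point N a) (factorial_monom_coeff \<mu>) =
      (\<Sum>n\<in>?M. (\<Sum>m\<in>?O. Poly_Mapping.lookup (falling_monom m) n) * a ^ mdeg n)"
    using coeff by (subst series_eval_const_point[OF coeff_deg]) (auto intro!: sum.cong)
  also have "\<dots> = (\<Sum>m\<in>?O. \<Sum>n\<in>?M. Poly_Mapping.lookup (falling_monom m) n * a ^ mdeg n)"
    unfolding sum_distrib_right by (rule sum.swap)
  also have "\<dots> = (\<Sum>m\<in>?O. poly_eval (const_point N a) (falling_monom m))"
    unfolding poly_eval_def
    by (intro sum.cong refl series_eval_const_point(1)[symmetric]) (use expr_deg in blast)
  also have "\<dots> = (\<Sum>m\<in>?O. \<Prod>i<length \<mu>. \<Prod>k<\<mu> ! i. (a - of_nat k))"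
  proof (intro sum.cong refl)
    fix m
    assume m: "m \<in> ?O"
    then obtain q where q: "bij q" "m = Poly_Mapping.map_key q (Poly_Mapping.nth \<mu>)"
      by (auto simp: monom_orbit_def)
    have "poly_eval (const_point N a) (falling_monom m) =
        (\<Prod>i\<in>Poly_Mapping.keys m. \<Prod>k<Poly_Mapping.lookup m i. (a - of_nat k))"
      unfolding poly_eval_falling_monom using m by (intro prod.cong) auto
    also have "\<dots> = (\<Prod>i<length \<mu>. \<Prod>k<\<mu> ! i. (a - of_nat k))"
      unfolding q(2)
      by (subst prod_map_key[OF q(1)])
        (auto simp: keys_nth_partition[OF \<mu>] nth_default_nth simp del: keys_nth intro!: prod.cong)
    finally show "poly_eval (const_point N a) (falling_monom m) = (\<Prod>i<length \<mu>. \<Prod>k<\<mu> ! i. (a - of_nat k))" .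
  qed
  also have "\<dots> = of_nat (N choose length \<mu>) * fact (length \<mu>) / mult_fact \<mu> *
      (\<Prod>i<length \<mu>. \<Prod>k<\<mu> ! i. (a - of_nat k))"
    by (simp add: card_orbit[OF \<mu>])
  finally show ?thesis .
qed


section \<open>The specialization\<close>

definition specialize_coeff :: "complex \<Rightarrow> complex \<Rightarrow> monom \<Rightarrow> complex" where
  "specialize_coeff t a m =
     a ^ (mdeg m - card (Poly_Mapping.keys m)) * (\<Prod>i<card (Poly_Mapping.keys m). - (t + of_nat i * a)) /
     fact (card (Poly_Mapping.keys m))"

text \<open>
  The support of \<open>m\<close> is required to be an initial segment, which picks one representative for
  each support size.
\<close>

definition specialize :: "complex \<Rightarrow> complex \<Rightarrow> (monom \<Rightarrow> complex) \<Rightarrow> complex" where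
  "specialize t a f =
     (\<Sum>m | Poly_Mapping.keys m \<in> range lessThan \<and> f m \<noteq> 0. f m * specialize_coeff t a m)"

definition packed_monoms :: "nat \<Rightarrow> monom set" where
  "packed_monoms d = {m. Poly_Mapping.keys m \<in> range lessThan \<and> mdeg m \<le> d}"

lemma finite_packed_monoms: "finite (packed_monoms d)"
proof (rule finite_subset)
  have "Poly_Mapping.keys m \<subseteq> {..<d}" if "m \<in> packed_monoms d" for m
  proof -
    from that obtain l where l: "Poly_Mapping.keys m = {..<l}" and "mdeg m \<le> d"
      unfolding packed_monoms_def by blast
    then have "l \<le> d"
      using card_keys_le_mdeg[of m] by simp
    with l show ?thesis
      by simp
  qed
  then show "packed_monoms d \<subseteq> {m. Poly_Mapping.keys m \<subseteq> {..<d} \<and> mdeg m \<le> d}"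
    by (auto simp: packed_monoms_def)
qed (simp add: finite_monoms)

text \<open>The index set depends only on a degree bound, so that values of different series can be
  compared term by term.\<close>

lemma specialize_superset:
  assumes "\<forall>m. f m \<noteq> 0 \<longrightarrow> mdeg m \<le> d"
  shows "specialize t a f = (\<Sum>m\<in>packed_monoms d. f m * specialize_coeff t a m)"
  unfolding specialize_def
  by (rule sum.mono_neutral_left[OF finite_packed_monoms]) (use assms in \<open>auto simp: packed_monoms_def\<close>)

lemma specialize_coeff_natural:
  "specialize_coeff (- of_nat N * a) a m = of_nat (N choose card (Poly_Mapping.keys m)) * a ^ mdeg m"
proof -
  let ?l = "card (Poly_Mapping.keys m)"
  have "(\<Prod>i<?l. - (- of_nat N * a + of_nat i * a)) = (\<Prod>i<?l. a * (of_nat N - of_nat i))"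
    by (intro prod.cong) (simp_all add: algebra_simps)
  also have "\<dots> = a ^ ?l * (\<Prod>i<?l. of_nat N - of_nat i)"
    by (simp add: prod.distrib)
  also have "(\<Prod>i<?l. of_nat N - of_nat i) = of_nat (N choose ?l) * (fact ?l :: complex)"
    by (simp add: binomial_gbinomial gbinomial_prod_rev lessThan_atLeast0)
  finally show ?thesis
    using card_keys_le_mdeg[of m] by (simp add: specialize_coeff_def flip: power_add)
qed

text \<open>Grouping by support size turns both sides into sums of binomial coefficients times
  \<open>support_sum\<close>; they differ only in the range of l.\<close>

lemma specialize_natural:
  assumes "symmetric_series f" "bounded_degree f"
  shows "specialize (- of_nat N * a) a f = series_eval (const_point N a) f"
proof -
  obtain d where d: "\<forall>m. f m \<noteq> 0 \<longrightarrow> mdeg m \<le> d"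
    using assms(2) unfolding bounded_degree_def by blast
  let ?T = "\<lambda>l. of_nat (N choose l) * support_sum f a d {..<l}"
  have "specialize (- of_nat N * a) a f =
      (\<Sum>m\<in>packed_monoms d. of_nat (N choose card (Poly_Mapping.keys m)) * (f m * a ^ mdeg m))"
    unfolding specialize_superset[OF d] specialize_coeff_natural by (simp only: mult_ac)
  also have "\<dots> = (\<Sum>l\<le>d. \<Sum>m | m \<in> packed_monoms d \<and> card (Poly_Mapping.keys m) = l.
      of_nat (N choose card (Poly_Mapping.keys m)) * (f m * a ^ mdeg m))"
    by (rule sum.group[symmetric, OF finite_packed_monoms])
      (auto simp: packed_monoms_def intro: order_trans[OF card_keys_le_mdeg])
  also have "\<dots> = (\<Sum>l\<le>d. ?T l)"
  proof (intro sum.cong refl)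
    fix l
    have "S \<in> range lessThan \<and> card S = l \<longleftrightarrow> S = {..<l}" for S
      by auto
    then have "{m. m \<in> packed_monoms d \<and> card (Poly_Mapping.keys m) = l} = {m. Poly_Mapping.keys m = {..<l} \<and> mdeg m \<le> d}"
      unfolding packed_monoms_def by blast
    then show "(\<Sum>m | m \<in> packed_monoms d \<and> card (Poly_Mapping.keys m) = l.
        of_nat (N choose card (Poly_Mapping.keys m)) * (f m * a ^ mdeg m)) = ?T l"
      unfolding support_sum_def sum_distrib_left
      by (rule sum.cong) (simp only: mem_Collect_eq card_lessThan)
  qed
  \<comment> \<open>A common range for both sums: terms with l > d vanish because l variables force
    degree at least l, and terms with l > N because of the binomial coefficient.\<close>
  also have "\<dots> = (\<Sum>l\<le>N + d. ?T l)"
    by (rule sum.mono_neutral_left) (auto simp: support_sum_large)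
  also have "\<dots> = (\<Sum>l\<le>N. ?T l)"
    by (rule sum.mono_neutral_right) (auto simp: binomial_eq_0)
  also have "\<dots> = series_eval (const_point N a) f"
    unfolding series_eval_const_point(1)[OF d] sum_symmetric_monoms[OF assms(1)] ..
  finally show ?thesis .
qed

section \<open>Extension from t = - N a to all parameters\<close>

lemma specialize_poly:
  assumes "bounded_degree f"
  obtains p where "\<And>t. specialize t a f = poly p t"
proof -
  obtain d where d: "\<forall>m. f m \<noteq> 0 \<longrightarrow> mdeg m \<le> d"
    using assms unfolding bounded_degree_def by blast
  let ?c = "\<lambda>m. f m * (a ^ (mdeg m - card (Poly_Mapping.keys m)) / fact (card (Poly_Mapping.keys m)))"
  have "specialize t a f = poly (\<Sum>m\<in>packed_monoms d. smult (?c m)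
      (\<Prod>i<card (Poly_Mapping.keys m). [:- (of_nat i * a), - 1:])) t" for t
    by (simp add: specialize_superset[OF d] specialize_coeff_def poly_sum poly_prod algebra_simps)
  then show thesis
    by (rule that)
qed

lemma continuous_specialize:
  assumes "bounded_degree f"
  shows "continuous_on UNIV (\<lambda>a. specialize t a f)"
proof -
  obtain d where d: "\<forall>m. f m \<noteq> 0 \<longrightarrow> mdeg m \<le> d"
    using assms unfolding bounded_degree_def by blast
  show ?thesis
    unfolding specialize_superset[OF d] specialize_coeff_def by (intro continuous_intros) simp
qed

text \<open>For fixed a \<noteq> 0, the points - N a are infinitely many zeros of a polynomial in t,
  which is therefore 0. The case a = 0 follows by letting a tend to 0 with t fixed.\<close>

lemma zero_of_zero_on_lattice:
  fixes G :: "complex \<Rightarrow> complex \<Rightarrow> complex"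
  assumes poly: "\<And>a. \<exists>p. \<forall>t. G t a = poly p t"
    and cont: "\<And>t. continuous_on UNIV (G t)"
    and zero: "\<And>N a. a \<noteq> 0 \<Longrightarrow> G (- of_nat N * a) a = 0"
  shows "G t a = 0"
proof -
  have nz: "G t a = 0" if "a \<noteq> 0" for a t
  proof -
    obtain p where p: "\<And>t. G t a = poly p t"
      using poly by blast
    have "inj (\<lambda>N::nat. - of_nat N * a)"
      using that by (auto simp: inj_def)
    then have "infinite (range (\<lambda>N::nat. - of_nat N * a))"
      by (rule range_inj_infinite)
    moreover have "range (\<lambda>N::nat. - of_nat N * a) \<subseteq> {t. poly p t = 0}"
      using zero[OF that] p by auto
    ultimately have "p = 0"
      using poly_roots_finite finite_subset by blast
    then show ?thesis
      by (simp add: p)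
  qed
  show ?thesis
  proof (cases "a = 0")
    case True
    have "(G t \<longlongrightarrow> G t 0) (at 0)"
      using cont[of t] by (simp add: continuous_on_def)
    moreover have "(G t \<longlongrightarrow> 0) (at 0)"
      by (rule tendsto_eventually) (auto simp: eventually_at_filter nz)
    ultimately show ?thesis
      using True by (metis at_neq_bot tendsto_unique)
  qed (rule nz)
qed

text \<open>At t = - N a the specialization is an evaluation at a point, hence multiplicative;
  \<open>zero_of_zero_on_lattice\<close> is applied to the difference of both sides.\<close>

lemma specialize_mult:
  assumes f: "symmetric_series f" "bounded_degree f" and g: "symmetric_series g" "bounded_degree g"
  shows "specialize t a (cauchy_prod f g) = specialize t a f * specialize t a g"
proof -
  note fg = symmetric_series_cauchy_prod[OF f(1) g(1)] bounded_degree_cauchy_prod[OF f(2) g(2)]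
  define G where "G t a = specialize t a (cauchy_prod f g) - specialize t a f * specialize t a g" for t a
  have "G t a = 0"
  proof (rule zero_of_zero_on_lattice[of G])
    fix a
    obtain p q r where "\<And>t. specialize t a (cauchy_prod f g) = poly p t" "\<And>t. specialize t a f = poly q t"
      "\<And>t. specialize t a g = poly r t"
      using specialize_poly f(2) g(2) fg(2) by metis
    then show "\<exists>p. \<forall>t. G t a = poly p t"
      by (intro exI[of _ "p - q * r"]) (simp add: G_def)
  next
    fix t
    show "continuous_on UNIV (G t)"
      unfolding G_def[abs_def] by (intro continuous_intros continuous_specialize f g fg)
  next
    fix N a
    have fin: "finite {m. h m * mon_eval (const_point N a) m \<noteq> 0}" if "bounded_degree h" for h
      using that unfolding bounded_degree_def by (elim exE) (rule series_eval_const_point(2))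
    show "G (- of_nat N * a) a = 0"
      unfolding G_def specialize_natural[OF f] specialize_natural[OF g] specialize_natural[OF fg]
        series_eval_cauchy_prod[OF fin[OF f(2)] fin[OF g(2)]] by simp
  qed
  then show ?thesis
    by (simp add: G_def)
qed

text \<open>The factor with j = 0 is a, and the other k - 1 factors are those of
  \<open>row_weight\<close> with opposite sign. One sign stays with a, so that each row supplies a
  factor - a.\<close>

lemma falling_row_weight:
  "k \<ge> 1 \<Longrightarrow> (\<Prod>j<k. a - of_nat j) = (-1) ^ k * (- a * row_weight a k)"
  by (induction k rule: dec_induct) (simp_all add: row_weight_def algebra_simps)

text \<open>At t = - N a, the factors - a of the l rows are distributed over N (N - 1) ... (N - l +
  1), and (N - i)(- a) is t + i a. Both sides are polynomial in t and continuous in a.\<close>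

lemma specialize_factorial_monom:
  assumes \<mu>: "is_partition \<mu>"
  shows "specialize t a (factorial_monom_coeff \<mu>) =
    (-1) ^ sum_list \<mu> * (\<Prod>i<length \<mu>. t + of_nat i * a) * (prod_list (map (row_weight a) \<mu>) / mult_fact \<mu>)"
proof -
  have sb: "symmetric_series (factorial_monom_coeff \<mu>)" "bounded_degree (factorial_monom_coeff \<mu>)"
    using coeff_sf[of "factorial_monom_sf \<mu>"] by (simp_all add: factorial_monom_sf.rep_eq)
  define H where "H t a = (-1) ^ sum_list \<mu> * (\<Prod>i<length \<mu>. t + of_nat i * a) *
    (prod_list (map (row_weight a) \<mu>) / mult_fact \<mu>)" for t a
  define G where "G t a = specialize t a (factorial_monom_coeff \<mu>) - H t a" for t a
  have "G t a = 0"
  proof (rule zero_of_zero_on_lattice[of G])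
    fix a
    obtain p where p: "\<And>t. specialize t a (factorial_monom_coeff \<mu>) = poly p t"
      using specialize_poly[OF sb(2)] by metis
    show "\<exists>p. \<forall>t. G t a = poly p t"
      by (rule exI[of _ "p - smult ((-1) ^ sum_list \<mu> * (prod_list (map (row_weight a) \<mu>) / mult_fact \<mu>))
          (\<Prod>i<length \<mu>. [:of_nat i * a, 1:])"])
        (simp add: G_def H_def p poly_prod algebra_simps)
  next
    fix t
    have "continuous_on UNIV (\<lambda>a. prod_list (map (row_weight a) \<mu>))"
      by (induction \<mu>) (auto simp: row_weight_def intro!: continuous_intros)
    then show "continuous_on UNIV (G t)"
      unfolding G_def[abs_def] H_def by (intro continuous_intros continuous_specialize sb) auto
  next
    fix N a
    let ?l = "length \<mu>"
    have "(\<Prod>i<?l. \<Prod>k<\<mu> ! i. (a - of_nat k)) = (\<Prod>i<?l. (-1) ^ (\<mu> ! i) * (- a * row_weight a (\<mu> ! i)))"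
      by (intro prod.cong refl falling_row_weight is_partition_nth_pos[OF \<mu>]) simp
    also have "\<dots> = (-1) ^ sum_list \<mu> * ((- a) ^ ?l * prod_list (map (row_weight a) \<mu>))"
      by (simp add: prod.distrib sum_list_sum_nth prod.list_conv_set_nth lessThan_atLeast0 power_sum
          del: mult_minus_left mult_minus_right)
    finally have 1: "(\<Prod>i<?l. \<Prod>k<\<mu> ! i. (a - of_nat k)) = \<dots>" .
    have "of_nat (N choose ?l) * fact ?l = (\<Prod>i<?l. of_nat N - of_nat i :: complex)"
      by (simp add: binomial_gbinomial gbinomial_prod_rev lessThan_atLeast0)
    then have "of_nat (N choose ?l) * fact ?l * (- a) ^ ?l = (\<Prod>i<?l. (of_nat N - of_nat i) * - a)"
      by (simp only: prod.distrib prod_constant card_lessThan)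
    also have "\<dots> = (\<Prod>i<?l. - of_nat N * a + of_nat i * a)"
      by (intro prod.cong) (simp_all add: algebra_simps)
    finally have 2: "(\<Prod>i<?l. - of_nat N * a + of_nat i * a) = of_nat (N choose ?l) * fact ?l * (- a) ^ ?l" ..
    show "G (- of_nat N * a) a = 0"
      unfolding G_def H_def specialize_natural[OF sb] series_eval_factorial_monom[OF \<mu>] 1 2 by simp
  qed
  then show ?thesis
    by (simp add: G_def H_def)
qed

section \<open>Unit, linearity and the resulting functional\<close>

lemma specialize_one: "specialize t a (\<lambda>m. if m = 0 then 1 else 0) = 1"
proof -
  have "{m :: monom. Poly_Mapping.keys m \<in> range lessThan \<and> (if m = 0 then 1 else 0 :: complex) \<noteq> 0} = {0}"
    by auto
  then show ?thesis
    unfolding specialize_def by (simp add: specialize_coeff_def)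
qed

lemma specialize_add:
  assumes "bounded_degree f" "bounded_degree g"
  shows "specialize t a (\<lambda>m. f m + g m) = specialize t a f + specialize t a g"
proof -
  obtain d e where d: "\<forall>m. f m \<noteq> 0 \<longrightarrow> mdeg m \<le> d" and e: "\<forall>m. g m \<noteq> 0 \<longrightarrow> mdeg m \<le> e"
    using assms unfolding bounded_degree_def by blast
  then have f: "\<forall>m. f m \<noteq> 0 \<longrightarrow> mdeg m \<le> max d e" and g: "\<forall>m. g m \<noteq> 0 \<longrightarrow> mdeg m \<le> max d e"
    by (meson max.coboundedI1 max.coboundedI2)+
  then have fg: "\<forall>m. f m + g m \<noteq> 0 \<longrightarrow> mdeg m \<le> max d e"
    by (metis add.right_neutral)
  show ?thesis
    unfolding specialize_superset[OF f] specialize_superset[OF g] specialize_superset[OF fg]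
    by (simp add: sum.distrib distrib_right)
qed

lemma specialize_scale:
  assumes "bounded_degree f"
  shows "specialize t a (\<lambda>m. c * f m) = c * specialize t a f"
proof -
  obtain d where d: "\<forall>m. f m \<noteq> 0 \<longrightarrow> mdeg m \<le> d"
    using assms unfolding bounded_degree_def by blast
  then have cf: "\<forall>m. c * f m \<noteq> 0 \<longrightarrow> mdeg m \<le> d"
    by simp
  show ?thesis
    unfolding specialize_superset[OF d] specialize_superset[OF cf] by (simp add: sum_distrib_left mult.assoc)
qed

theorem theorem4p1:
  fixes t \<alpha> :: complex
  assumes "\<forall>k::nat. k \<ge> 1 \<longrightarrow> t \<noteq> - of_nat k"
  shows "kingman_harmonic (kingman_phi t \<alpha>) \<and>
    (\<exists>\<pi> :: symfun \<Rightarrow> complex.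
       Vector_Spaces.linear scale_sf (*) \<pi> \<and>
       \<pi> 1 = 1 \<and>
       (\<forall>f g. \<pi> (f * g) = \<pi> f * \<pi> g) \<and>
       (\<forall>\<mu>. is_partition \<mu> \<longrightarrow>
          \<pi> (factorial_monom_sf \<mu>) =
            (-1) ^ sum_list \<mu> * fact_quot \<mu> * (\<Prod>i<length \<mu>. t + of_nat i * \<alpha>) * box_prod \<alpha> \<mu>) \<and>
       (\<forall>\<mu>. is_partition \<mu> \<longrightarrow>
          kingman_phi t \<alpha> \<mu> * pochhammer t (sum_list \<mu>) =
            (-1) ^ sum_list \<mu> * \<pi> (factorial_monom_sf \<mu>)) \<and>
       (\<forall>\<mu>. is_partition \<mu> \<and> (t \<noteq> 0 \<or> \<mu> = []) \<longrightarrow>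
          kingman_phi t \<alpha> \<mu> =
            (-1) ^ sum_list \<mu> * \<pi> (factorial_monom_sf \<mu>) / pochhammer t (sum_list \<mu>)))"
proof -
  define \<pi> where "\<pi> f = specialize t \<alpha> (coeff_sf f)" for f
  have sb: "symmetric_series (coeff_sf f)" "bounded_degree (coeff_sf f)" for f
    using coeff_sf[of f] by auto
  have pi_monom: "\<pi> (factorial_monom_sf \<mu>) =
      (-1) ^ sum_list \<mu> * fact_quot \<mu> * (\<Prod>i<length \<mu>. t + of_nat i * \<alpha>) * box_prod \<alpha> \<mu>"
    if "is_partition \<mu>" for \<mu>
    unfolding \<pi>_def factorial_monom_sf.rep_eq specialize_factorial_monom[OF that]
    using that by (simp add: is_partition_def mult_ac flip: fact_quot_box_prod)
  have sq: "(-1) ^ n * ((-1) ^ n * x) = (x :: complex)" for n x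
    by (simp flip: mult.assoc power_mult_distrib)
  \<comment> \<open>The zeros of the Pochhammer symbol are 0, -1, ..., -(n - 1), and the assumption
    on t leaves only 0.\<close>
  have poch: "pochhammer t n \<noteq> 0" if "t \<noteq> 0" for n
    using assms that by (auto simp: pochhammer_eq_0_iff) (metis Suc_leI neq0_conv of_nat_0 neg_0_equal_iff_equal One_nat_def)
  have phi: "kingman_phi t \<alpha> \<mu> = (-1) ^ sum_list \<mu> * \<pi> (factorial_monom_sf \<mu>) / pochhammer t (sum_list \<mu>)"
    if "is_partition \<mu>" "t \<noteq> 0 \<or> \<mu> = []" for \<mu>
    unfolding pi_monom[OF that(1)] kingman_phi_eq[OF that(2)] mult.assoc sq by simp
  have "kingman_phi t \<alpha> \<mu> * pochhammer t (sum_list \<mu>) = (-1) ^ sum_list \<mu> * \<pi> (factorial_monom_sf \<mu>)"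
    if "is_partition \<mu>" for \<mu>
  proof (cases "t \<noteq> 0 \<or> \<mu> = []")
    case True
    then have "pochhammer t (sum_list \<mu>) \<noteq> 0"
      using poch by auto
    then show ?thesis
      using phi[OF that True] by simp
  next
    \<comment> \<open>For t = 0 and nonempty \<mu>, both sides vanish: the Pochhammer symbol and the
      product over the rows each contain the factor t.\<close>
    case False
    then have "sum_list \<mu> > 0" and zero: "(\<Prod>i<length \<mu>. t + of_nat i * \<alpha>) = 0"
      using that by (cases \<mu>; auto simp: is_partition_def intro!: prod_zero bexI[of _ 0])+
    then obtain n where "sum_list \<mu> = Suc n"
      using gr0_implies_Suc by blast
    then have "pochhammer t (sum_list \<mu>) = 0"
      using False by (simp add: pochhammer_rec)
    then show ?thesis
      unfolding pi_monom[OF that] zero by simp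
  qed
  moreover have "Vector_Spaces.linear scale_sf (*) \<pi>"
    by unfold_locales
      (simp_all add: \<pi>_def plus_symfun.rep_eq scale_sf.rep_eq specialize_add specialize_scale sb algebra_simps)
  moreover have "\<pi> 1 = 1" "\<pi> (f * g) = \<pi> f * \<pi> g" for f g
    by (simp_all add: \<pi>_def one_symfun.rep_eq times_symfun.rep_eq specialize_one specialize_mult sb)
  ultimately show ?thesis
    using kingman_harmonic_phi[OF assms, of \<alpha>] pi_monom phi by blast
qed

end
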